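(* For $a\in\mathbb{C}^\ell$, let $$W^{-1}(a)=\{\gamma\in G\setminus\{0\} : a\in W_\gamma\cap W_{-\gamma}\}.$$ If, for any $a\in\mathbb{C}^\ell\setminus\{0\}$, the set $W^{-1}(a)$ is contained in a subgroup of $G$ of size $K$, then $\dim_{\mathrm H}\mu\ge1-\frac{\log K}{\log m}$ for any $\mu\in\mathfrak{W}$.
   Context: Fix integers $m\ge 3$ and $\ell\ge 1$. Consider a probability space with an $m$-uniform filtration $\mathcal{F}=\{\mathcal{F}_n\}_{n\ge0}$: $\mathcal{F}_0$ is trivial, each $\mathcal{F}_n$ is a finite algebra with set of atoms $\mathcal{AF}_n$, and each atom in $\mathcal{F}_n$ is split into $m$ atoms of $\mathcal{F}_{n+1}$ (its children) of equal probability. The probability space is identified with the compact metric space $\mathbb{T}$ of infinite paths $\gamma=(\gamma(0)\supset\gamma(1)\supset\cdots)$, $\gamma(n)\in\mathcal{AF}_n$, in the tree of atoms, with $\mathrm{dist}(\gamma_1,\gamma_2)=m^{-d}$, $d=\max\{n : \gamma_1(j)=\gamma_2(j)\text{ for all }j<n\}$ for $\gamma_1\ne\gamma_2$; an atom $\omega\in\mathcal{AF}_n$ is identified with the cylinder $\{\gamma : \gamma(n)=\omega\}$, of probability $m^{-n}$. Translation invariant setting (complex scalars): the set $\{1,\dots,m\}$ is equipped with a commutative group structure $G$ (written additively), and the dual group of $G$ is identified with $G$ by a fixed isomorphism, so that the Fourier transform $\hat f$ of $f\colon G\to\mathbb{C}^\ell$ is a function on $G$. For each $\gamma\in G\setminus\{0\}$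 a linear subspace $W_\gamma\subset\mathbb{C}^\ell$ is fixed, and $$W=\{f\colon G\to\mathbb{C}^\ell : \textstyle\sum_{z\in G}f(z)=0,\ \hat f(\gamma)\in W_\gamma\ \ \forall\gamma\in G\setminus\{0\}\}.$$ For each $n$ and $\omega\in\mathcal{AF}_n$ fix a bijection $J_\omega$ from $\{1,\dots,m\}=G$ onto the set of children of $\omega$; for $f\in W$ let $J_\omega[f]$ be the function on $\omega$ equal to $f(j)$ on the child $J_\omega(j)$. $\mathfrak{W}$ is the space of $\mathbb{C}^\ell$-valued martingales $F=\{F_n\}_{n\ge0}$ adapted to $\mathcal{F}$ with $\sup_n\mathbb{E}\|F_n\|<\infty$ and $(F_{n+1}-F_n)|_\omega\in J_\omega[W]$ for all $n\ge0$, $\omega\in\mathcal{AF}_n$. Each $\mathbb{C}^\ell$-valued Borel measure $\mu$ of bounded variation on $\mathbb{T}$ generates the martingale $F_n=\sum_{\omega\in\mathcal{AF}_n}m^n\mu(\omega)\chi_\omega$, and $\mu\in\mathfrak{W}$ means that this martingale lies in $\mathfrak{W}$. The lower Hausdorff dimension is $$\dim_{\mathrm H}\mu=\inf\{\alpha : \exists\text{ Borel }E\subset\mathbb{T}\text{ with }\mu(E)\ne0,\ \dim_{\mathrm H}E\le\alpha\}.$$ *)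

theory Defs
  imports "HOL-Analysis.Analysis" "HOL-Probability.Probability" "HOL-Algebra.Group"
begin

section \<open>Hausdorff dimension in a metric space\<close>

context Metric_space
begin

definition borel_sets :: "'a set set" where
  "borel_sets = sigma_sets M {U. openin mtopology U}"

text \<open>The \<open>s\<close>-th power of the diameter. The empty set contributes nothing for every \<open>s\<close>, and
  \<open>s = 0\<close> is separated because \<open>0 powr 0 = 0\<close>. It is only used for sets of finite diameter.\<close>
definition diam_pow :: "real \<Rightarrow> 'a set \<Rightarrow> real" where
  "diam_pow s U =
     (if U = {} then 0 else if s = 0 then 1 else (SUP p\<in>U \<times> U. d (fst p) (snd p)) powr s)"

definition hausdorff_premeasure :: "real \<Rightarrow> real \<Rightarrow> 'a set \<Rightarrow> ennreal" where
  "hausdorff_premeasure s \<delta> E =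
     (INF C \<in> {C :: nat \<Rightarrow> 'a set. E \<subseteq> (\<Union>i. C i) \<and>
                 (\<forall>i. C i \<subseteq> M \<and> (\<forall>x\<in>C i. \<forall>y\<in>C i. d x y \<le> \<delta>))}.
        \<Sum>i. ennreal (diam_pow s (C i)))"

definition hausdorff_measure :: "real \<Rightarrow> 'a set \<Rightarrow> ennreal" where
  "hausdorff_measure s E = (SUP \<delta>\<in>{0<..}. hausdorff_premeasure s \<delta> E)"

definition hausdorff_dim :: "'a set \<Rightarrow> ereal" where
  "hausdorff_dim E = Inf {ereal s | s. 0 \<le> s \<and> hausdorff_measure s E = 0}"

definition bounded_variation_measure :: "('a set \<Rightarrow> 'b::real_normed_vector) \<Rightarrow> bool" where
  "bounded_variation_measure \<mu> \<longleftrightarrow>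
     (\<forall>A :: nat \<Rightarrow> 'a set. range A \<subseteq> borel_sets \<longrightarrow> disjoint_family A \<longrightarrow>
        (\<lambda>i. \<mu> (A i)) sums \<mu> (\<Union>i. A i)) \<and>
     (\<exists>C. \<forall>P. finite P \<longrightarrow> P \<subseteq> borel_sets \<longrightarrow> disjoint P \<longrightarrow> (\<Sum>A\<in>P. norm (\<mu> A)) \<le> C)"

definition lower_hausdorff_dim :: "('a set \<Rightarrow> 'b::real_normed_vector) \<Rightarrow> ereal" where
  "lower_hausdorff_dim \<mu> = Inf {\<alpha>. \<exists>E\<in>borel_sets. \<mu> E \<noteq> 0 \<and> hausdorff_dim E \<le> \<alpha>}"

end

section \<open>Uniform filtrations and the tree of atoms\<close>

text \<open>The measures \<open>F n\<close> only serve as carriers of the algebras \<open>sets (F n)\<close>; probabilities are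
  always taken in the ambient space \<open>M\<close>.\<close>

definition atoms :: "'w measure \<Rightarrow> 'w set set" where
  "atoms A = {\<omega> \<in> sets A. \<omega> \<noteq> {} \<and> (\<forall>B \<in> sets A. B \<subset> \<omega> \<longrightarrow> B = {})}"

definition children :: "(nat \<Rightarrow> 'w measure) \<Rightarrow> nat \<Rightarrow> 'w set \<Rightarrow> 'w set set" where
  "children F n \<omega> = {\<omega>' \<in> atoms (F (Suc n)). \<omega>' \<subseteq> \<omega>}"

locale uniform_filtration = prob_space M + filtration "space M" F
  for M :: "'w measure" and F :: "nat \<Rightarrow> 'w measure" +
  fixes m :: nat
  assumes subalgebra_F: "subalgebra M (F n)"
    and finite_F: "finite (sets (F n))"
    and trivial_F: "sets (F 0) = {{}, space M}"
    and card_children: "\<omega> \<in> atoms (F n) \<Longrightarrow> card (children F n \<omega>) = m"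
    and equal_prob: "\<omega> \<in> atoms (F n) \<Longrightarrow> \<omega>\<^sub>1 \<in> children F n \<omega> \<Longrightarrow> \<omega>\<^sub>2 \<in> children F n \<omega> \<Longrightarrow>
      measure M \<omega>\<^sub>1 = measure M \<omega>\<^sub>2"

definition paths :: "(nat \<Rightarrow> 'w measure) \<Rightarrow> (nat \<Rightarrow> 'w set) set" where
  "paths F = {\<gamma>. \<forall>n. \<gamma> n \<in> atoms (F n) \<and> \<gamma> (Suc n) \<subseteq> \<gamma> n}"

definition path_dist :: "nat \<Rightarrow> (nat \<Rightarrow> 'w set) \<Rightarrow> (nat \<Rightarrow> 'w set) \<Rightarrow> real" where
  "path_dist m \<gamma>\<^sub>1 \<gamma>\<^sub>2 =
     (if \<gamma>\<^sub>1 = \<gamma>\<^sub>2 then 0 else 1 / real m ^ Max {n. \<forall>j<n. \<gamma>\<^sub>1 j = \<gamma>\<^sub>2 j})"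

definition cylinder :: "(nat \<Rightarrow> 'w measure) \<Rightarrow> nat \<Rightarrow> 'w set \<Rightarrow> (nat \<Rightarrow> 'w set) set" where
  "cylinder F n \<omega> = {\<gamma> \<in> paths F. \<gamma> n = \<omega>}"

lemma Metric_space_paths:
  assumes "m \<ge> 2"
  shows "Metric_space (paths F) (path_dist m)"
proof
  let ?S = "\<lambda>x y :: nat \<Rightarrow> 'w set. {n. \<forall>j<n. x j = y j}"
  have fin: "finite (?S x y)" if "x \<noteq> y" for x y
  proof -
    obtain k where "x k \<noteq> y k" using \<open>x \<noteq> y\<close> by (meson ext)
    then have "?S x y \<subseteq> {..k}" by (auto simp: atMost_def)
    then show ?thesis by (rule finite_subset) auto
  qed
  fix x y z :: "nat \<Rightarrow> 'w set"
  show "0 \<le> path_dist m x y" by (simp add: path_dist_def)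
  show "path_dist m x y = path_dist m y x" by (simp add: path_dist_def eq_commute)
  show "path_dist m x y = 0 \<longleftrightarrow> x = y" using assms by (auto simp: path_dist_def)
  show "path_dist m x z \<le> path_dist m x y + path_dist m y z"
  proof (cases "x = y \<or> y = z \<or> x = z")
    case True
    then show ?thesis by (auto simp: path_dist_def)
  next
    case False
    let ?a = "Max (?S x y)" and ?b = "Max (?S y z)" and ?c = "Max (?S x z)"
    have "?a \<in> ?S x y" by (rule Max_in) (use False fin in blast)+
    moreover have "?b \<in> ?S y z" by (rule Max_in) (use False fin in blast)+
    ultimately have "min ?a ?b \<in> ?S x z" by simp
    then have "min ?a ?b \<le> ?c" using False fin by (intro Max_ge) auto
    then have "1 / real m ^ ?c \<le> 1 / real m ^ min ?a ?b"
      using assms by (intro divide_left_mono power_increasing) auto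
    also have "\<dots> \<le> 1 / real m ^ ?a + 1 / real m ^ ?b" by (simp add: min_def)
    finally show ?thesis using False by (simp add: path_dist_def)
  qed
qed

section \<open>Translation invariant spaces\<close>

definition circle_group :: "complex monoid" where
  "circle_group = \<lparr>carrier = sphere 0 1, mult = (*), one = 1\<rparr>"

definition dual_group :: "('g, 'b) monoid_scheme \<Rightarrow> ('g \<Rightarrow> complex) monoid" where
  "dual_group G = \<lparr>carrier = hom G circle_group \<inter> extensional (carrier G),
     mult = (\<lambda>\<phi> \<psi>. \<lambda>z\<in>carrier G. \<phi> z * \<psi> z), one = (\<lambda>z\<in>carrier G. 1)\<rparr>"

text \<open>The parameter \<open>\<Phi>\<close> is the identification of \<open>G\<close> with its dual; \<open>\<Phi> \<gamma>\<close> is the character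
  labelled by \<open>\<gamma>\<close>. The normalisation of the transform plays no role below, since it is only
  tested for membership in linear subspaces.\<close>
definition fourier ::
  "('g, 'b) monoid_scheme \<Rightarrow> ('g \<Rightarrow> 'g \<Rightarrow> complex) \<Rightarrow> ('g \<Rightarrow> complex ^ 'l) \<Rightarrow> 'g \<Rightarrow> complex ^ 'l" where
  "fourier G \<Phi> f \<gamma> = (\<Sum>z\<in>carrier G. cnj (\<Phi> \<gamma> z) *s f z)"

definition W_space ::
  "('g, 'b) monoid_scheme \<Rightarrow> ('g \<Rightarrow> 'g \<Rightarrow> complex) \<Rightarrow> ('g \<Rightarrow> (complex ^ 'l) set) \<Rightarrow>
     ('g \<Rightarrow> complex ^ 'l) set" where
  "W_space G \<Phi> V = {f \<in> carrier G \<rightarrow>\<^sub>E UNIV. (\<Sum>z\<in>carrier G. f z) = 0 \<and>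
     (\<forall>\<gamma>\<in>carrier G - {\<one>\<^bsub>G\<^esub>}. fourier G \<Phi> f \<gamma> \<in> V \<gamma>)}"

definition W_inv ::
  "('g, 'b) monoid_scheme \<Rightarrow> ('g \<Rightarrow> (complex ^ 'l) set) \<Rightarrow> complex ^ 'l \<Rightarrow> 'g set" where
  "W_inv G V a = {\<gamma> \<in> carrier G - {\<one>\<^bsub>G\<^esub>}. a \<in> V \<gamma> \<inter> V (inv\<^bsub>G\<^esub> \<gamma>)}"

section \<open>Martingales\<close>

text \<open>The last clause is \<open>E(X (n+1) | F n) = X n\<close>, written out because the library's conditional
  expectation is only available for real-valued functions.\<close>
definition martingale ::
  "'w measure \<Rightarrow> (nat \<Rightarrow> 'w measure) \<Rightarrow> (nat \<Rightarrow> 'w \<Rightarrow> complex ^ 'l) \<Rightarrow> bool" where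
  "martingale M F X \<longleftrightarrow>
     (\<forall>n. X n \<in> borel_measurable (F n) \<and> integrable M (X n) \<and>
        (\<forall>A\<in>sets (F n). set_lebesgue_integral M A (X (Suc n)) = set_lebesgue_integral M A (X n)))"

definition lift_to_atom ::
  "('g, 'b) monoid_scheme \<Rightarrow> ('w set \<Rightarrow> 'g \<Rightarrow> 'w set) \<Rightarrow> 'w set \<Rightarrow> ('g \<Rightarrow> complex ^ 'l) \<Rightarrow>
     'w \<Rightarrow> complex ^ 'l" where
  "lift_to_atom G J \<omega> f = (\<lambda>x\<in>\<omega>. f (THE j. j \<in> carrier G \<and> x \<in> J \<omega> j))"

definition W_martingales ::
  "'w measure \<Rightarrow> (nat \<Rightarrow> 'w measure) \<Rightarrow> ('g, 'b) monoid_scheme \<Rightarrow> ('w set \<Rightarrow> 'g \<Rightarrow> 'w set) \<Rightarrow>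
     ('g \<Rightarrow> complex ^ 'l) set \<Rightarrow> (nat \<Rightarrow> 'w \<Rightarrow> complex ^ 'l) set" where
  "W_martingales M F G J W = {X. martingale M F X \<and>
     bdd_above (range (\<lambda>n. \<integral>x. norm (X n x) \<partial>M)) \<and>
     (\<forall>n. \<forall>\<omega>\<in>atoms (F n). (\<lambda>x\<in>\<omega>. X (Suc n) x - X n x) \<in> lift_to_atom G J \<omega> ` W)}"

definition measure_martingale ::
  "(nat \<Rightarrow> 'w measure) \<Rightarrow> nat \<Rightarrow> ((nat \<Rightarrow> 'w set) set \<Rightarrow> complex ^ 'l) \<Rightarrow>
     nat \<Rightarrow> 'w \<Rightarrow> complex ^ 'l" where
  "measure_martingale F m \<mu> n x =
     (\<Sum>\<omega>\<in>atoms (F n). indicator \<omega> x *\<^sub>R (real m ^ n *\<^sub>R \<mu> (cylinder F n \<omega>)))"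

end

theory Submission
  imports Defs
begin

text \<open>The measure \<open>\<mu>\<close> has a total variation \<open>\<Lambda>\<close>, a finite positive measure, and a density \<open>f\<close> with
\<open>\<mu> = f \<Lambda>\<close>. Suppose that \<open>\<mu> E \<noteq> 0\<close>. Then \<open>f\<close> has an essential value \<open>a \<noteq> 0\<close> on \<open>E\<close>
(\<open>essential_value_exists\<close>): near it, \<open>\<mu>\<close> looks like the rank one measure \<open>a \<Lambda>\<close>. By a
Lebesgue density argument on the tree (\<open>density_points\<close>) there is a part \<open>A'\<close> of \<open>E\<close> of positive
mass such that, on every sufficiently small cylinder that meets \<open>A'\<close>, \<open>\<mu>\<close> is as close to \<open>a \<Lambda>\<close>
in variation as desired, relative to the mass of the cylinder.

The martingale condition now limits how \<open>\<Lambda>\<close> can concentrate. Let \<open>p j\<close> be the masses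
of the children of such a cylinder, and \<open>P\<close> its own mass. If \<open>\<mu>\<close> were exactly \<open>a \<Lambda>\<close> there, then
membership of the increment in \<open>W\<close> would say that \<open>a\<close> times the Fourier coefficient of \<open>p\<close> at
\<open>\<gamma>\<close> lies in \<open>W\<^sub>\<gamma>\<close> for every \<open>\<gamma> \<noteq> 0\<close>. As \<open>p\<close> is real, its coefficients at \<open>\<gamma>\<close> and \<open>-\<gamma>\<close> are
conjugate, so the spectrum of \<open>p\<close> lies in \<open>W\<^sup>-\<^sup>1(a) \<union> {0}\<close>, hence in a subgroup \<open>H\<close> with \<open>K\<close>
elements. As \<open>p \<ge> 0\<close>, no coefficient exceeds \<open>P\<close> in modulus, and Fourier inversion gives
\<open>p j \<le> (K / m) P\<close>. All this is stable: if \<open>a \<notin> W\<^sub>\<gamma>\<close>, then \<open>a\<close> has positive distance to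
\<open>W\<^sub>\<gamma>\<close>, and an error of size \<open>\<delta>\<close> costs only \<open>\<delta> / c\<close> (\<open>rank_one_mass_bound\<close>).

Hence, for every \<open>q > K / m\<close>, the masses of the cylinders around the points of \<open>A'\<close> eventually decay
by a factor \<open>q\<close> at each level, and the mass distribution principle (\<open>hausdorff_measure_nonzero\<close>) shows
that the \<open>s\<close>-dimensional Hausdorff measure of \<open>E\<close> is positive if \<open>q = m powr (- s)\<close>. The condition
\<open>q > K / m\<close> is exactly \<open>s < 1 - ln K / ln m\<close>.\<close>

section \<open>The total variation of a vector measure\<close>

definition countably_additive_vec :: "'a set set \<Rightarrow> ('a set \<Rightarrow> 'b::real_normed_vector) \<Rightarrow> bool" where
  "countably_additive_vec S \<mu> \<longleftrightarrow> (\<forall>A :: nat \<Rightarrow> 'a set. range A \<subseteq> S \<longrightarrow> disjoint_family A \<longrightarrow>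
     (\<lambda>i. \<mu> (A i)) sums \<mu> (\<Union>i. A i))"

definition subpartitions :: "'a set set \<Rightarrow> 'a set \<Rightarrow> 'a set set set" where
  "subpartitions S A = {P. finite P \<and> P \<subseteq> S \<and> disjoint P \<and> \<Union>P \<subseteq> A}"

definition variation :: "'a set set \<Rightarrow> ('a set \<Rightarrow> 'b::real_normed_vector) \<Rightarrow> 'a set \<Rightarrow> ennreal" where
  "variation S \<mu> A = (SUP P\<in>subpartitions S A. \<Sum>B\<in>P. ennreal (norm (\<mu> B)))"

lemma countably_additive_vec_empty:
  assumes "countably_additive_vec S \<mu>" "{} \<in> S"
  shows "\<mu> {} = 0"
proof -
  have "(\<lambda>i::nat. \<mu> {}) sums \<mu> {}"
    using assms unfolding countably_additive_vec_def
    by (elim allE[of _ "\<lambda>i::nat. {}"]) (auto simp: disjoint_family_on_def)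
  then have "summable (\<lambda>i::nat. \<mu> {})" by (rule sums_summable)
  then show ?thesis by (simp add: summable_const_iff)
qed

lemma subpartitions_empty: "{} \<in> subpartitions S A"
  by (auto simp: subpartitions_def)

text \<open>Subpartitions of disjoint sets can be put together; they can share at most the empty set, which
\<open>\<mu>\<close> does not charge.\<close>
lemma variation_superadditive:
  assumes mu: "\<mu> {} = 0" and disj: "A \<inter> B = {}"
  shows "variation S \<mu> A + variation S \<mu> B \<le> variation S \<mu> (A \<union> B)"
proof -
  let ?v = "\<lambda>P. \<Sum>B\<in>P. ennreal (norm (\<mu> B))"
  have *: "?v P + ?v Q \<le> variation S \<mu> (A \<union> B)"
    if P: "P \<in> subpartitions S A" and Q: "Q \<in> subpartitions S B" for P Q
  proof -
    have sub: "\<Union>P \<subseteq> A" "\<Union>Q \<subseteq> B" using P Q by (simp_all add: subpartitions_def)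
    then have un: "\<Union>P \<inter> \<Union>Q = {}" using disj by blast
    then have "P \<inter> Q \<subseteq> {{}}" by blast
    then have "?v P + ?v Q = ?v (P \<union> Q)"
      using P Q mu by (intro sum.union_inter_neutral[symmetric]) (auto simp: subpartitions_def)
    moreover have "P \<union> Q \<in> subpartitions S (A \<union> B)"
    proof -
      have "disjoint (P \<union> Q)"
        using P Q un by (intro disjoint_union) (simp_all add: subpartitions_def)
      moreover have "\<Union>(P \<union> Q) \<subseteq> A \<union> B" using sub by blast
      ultimately show ?thesis using P Q by (simp add: subpartitions_def)
    qed
    ultimately show ?thesis by (auto simp: variation_def intro: SUP_upper)
  qed
  have ne: "subpartitions S X \<noteq> {}" for X using subpartitions_empty by blast
  have "variation S \<mu> A + ?v Q \<le> variation S \<mu> (A \<union> B)" if "Q \<in> subpartitions S B" for Q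
    unfolding variation_def[of _ _ A] ennreal_SUP_add_left[OF ne, symmetric]
    using * that by (intro SUP_least)
  then show ?thesis
    unfolding variation_def[of _ _ B] ennreal_SUP_add_right[OF ne]
    by (intro SUP_least)
qed

lemma variation_mono: "A \<subseteq> B \<Longrightarrow> variation S \<mu> A \<le> variation S \<mu> B"
  unfolding variation_def by (intro SUP_subset_mono) (auto simp: subpartitions_def)

lemma norm_sums_le_suminf:
  fixes f :: "nat \<Rightarrow> 'b::real_normed_vector"
  assumes "f sums x"
  shows "ennreal (norm x) \<le> (\<Sum>i. ennreal (norm (f i)))"
proof -
  have "(\<lambda>n. ennreal (norm (\<Sum>i<n. f i))) \<longlonglongrightarrow> ennreal (norm x)"
    using assms unfolding sums_def by (intro tendsto_ennrealI tendsto_norm)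
  moreover have "ennreal (norm (\<Sum>i<n. f i)) \<le> (\<Sum>i. ennreal (norm (f i)))" for n
  proof -
    have "ennreal (norm (\<Sum>i<n. f i)) \<le> (\<Sum>i<n. ennreal (norm (f i)))"
      by (simp add: norm_sum ennreal_leI)
    also have "\<dots> \<le> (\<Sum>i. ennreal (norm (f i)))" by (rule sum_le_suminf) auto
    finally show ?thesis .
  qed
  ultimately show ?thesis by (intro LIMSEQ_le_const2) blast+
qed

text \<open>Superadditivity gives one inequality. For the other, each member of a subpartition of a disjoint
union is cut along the pieces of the union, which can only increase the sum of the norms, and the
two summations are interchanged.\<close>
lemma countably_additive_variation:
  assumes S: "sigma_algebra \<Omega> S" and mu: "countably_additive_vec S \<mu>"
  shows "countably_additive S (variation S \<mu>)"
  unfolding countably_additive_def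
proof (intro allI impI antisym)
  interpret sigma_algebra \<Omega> S by (rule S)
  fix A :: "nat \<Rightarrow> 'a set"
  assume A: "range A \<subseteq> S" "disjoint_family A" "(\<Union>i. A i) \<in> S"
  have mu0: "\<mu> {} = 0" by (rule countably_additive_vec_empty[OF mu empty_sets])
  let ?v = "\<lambda>P. \<Sum>B\<in>P. ennreal (norm (\<mu> B))"
  have fin: "(\<Sum>i<n. variation S \<mu> (A i)) \<le> variation S \<mu> (\<Union>i<n. A i)" for n
  proof (induction n)
    case (Suc n)
    have "A i \<inter> A n = {}" if "i < n" for i
      using that by (intro disjoint_family_onD[OF A(2)]) auto
    then have "(\<Union>i<n. A i) \<inter> A n = {}" by blast
    from variation_superadditive[where \<mu> = \<mu> and S = S, OF mu0 this]
    have "variation S \<mu> (\<Union>i<n. A i) + variation S \<mu> (A n) \<le> variation S \<mu> (\<Union>i<Suc n. A i)"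
      by (simp add: lessThan_Suc Un_commute)
    then show ?case using Suc by (metis (no_types, lifting) add_right_mono order_trans sum.lessThan_Suc)
  qed auto
  show "(\<Sum>i. variation S \<mu> (A i)) \<le> variation S \<mu> (\<Union>i. A i)"
    by (intro suminf_le_const) (auto intro!: order_trans[OF fin] variation_mono)
  show "variation S \<mu> (\<Union>i. A i) \<le> (\<Sum>i. variation S \<mu> (A i))"
    unfolding variation_def[of _ _ "\<Union>i. A i"]
  proof (rule SUP_least)
    fix P assume P: "P \<in> subpartitions S (\<Union>i. A i)"
    have "?v P \<le> (\<Sum>B\<in>P. \<Sum>i. ennreal (norm (\<mu> (B \<inter> A i))))"
    proof (rule sum_mono)
      fix B assume B: "B \<in> P"
      have "B \<in> S" using B P by (auto simp: subpartitions_def)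
      then have "range (\<lambda>i. B \<inter> A i) \<subseteq> S" using A(1) by blast
      moreover have "disjoint_family (\<lambda>i. B \<inter> A i)"
        using A(2) unfolding disjoint_family_on_def by blast
      ultimately have "(\<lambda>i. \<mu> (B \<inter> A i)) sums \<mu> (\<Union>i. B \<inter> A i)"
        using mu unfolding countably_additive_vec_def by blast
      moreover have "(\<Union>i. B \<inter> A i) = B" using B P by (auto simp: subpartitions_def)
      ultimately show "ennreal (norm (\<mu> B)) \<le> (\<Sum>i. ennreal (norm (\<mu> (B \<inter> A i))))"
        using norm_sums_le_suminf by metis
    qed
    also have "\<dots> = (\<Sum>i. \<Sum>B\<in>P. ennreal (norm (\<mu> (B \<inter> A i))))"
      by (subst suminf_sum) auto
    also have "\<dots> \<le> (\<Sum>i. variation S \<mu> (A i))"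
    proof (intro suminf_le)
      fix i
      let ?Q = "(\<lambda>B. B \<inter> A i) ` P"
      have Q: "?Q \<in> subpartitions S (A i)"
      proof -
        have "disjoint ?Q"
          unfolding disjoint_def
        proof (intro ballI impI)
          fix X Y assume "X \<in> ?Q" "Y \<in> ?Q" "X \<noteq> Y"
          then obtain B C where "B \<in> P" "C \<in> P" "B \<noteq> C" "X = B \<inter> A i" "Y = C \<inter> A i" by blast
          moreover have "B \<inter> C = {}"
            using P calculation(1-3) unfolding subpartitions_def disjoint_def by blast
          ultimately show "X \<inter> Y = {}" by blast
        qed
        moreover have "?Q \<subseteq> S" using P A(1) by (auto simp: subpartitions_def)
        ultimately show ?thesis using P by (auto simp: subpartitions_def)
      qed
      have "(\<Sum>B\<in>P. ennreal (norm (\<mu> (B \<inter> A i)))) = ?v ?Q"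
      \<comment> \<open>Distinct members of \<open>P\<close> can have the same trace on \<open>A i\<close> only if this trace is empty.\<close>
      proof (subst sum.reindex_nontrivial)
        show "finite P" using P by (auto simp: subpartitions_def)
        fix x y assume "x \<in> P" "y \<in> P" "x \<noteq> y" "x \<inter> A i = y \<inter> A i"
        moreover have "x \<inter> y = {}"
          using P calculation(1-3) unfolding subpartitions_def disjoint_def by blast
        ultimately have "x \<inter> A i = {}" by blast
        then show "ennreal (norm (\<mu> (x \<inter> A i))) = 0" using mu0 by simp
      qed auto
      also have "\<dots> \<le> variation S \<mu> (A i)"
        unfolding variation_def using Q by (rule SUP_upper)
      finally show "(\<Sum>B\<in>P. ennreal (norm (\<mu> (B \<inter> A i)))) \<le> variation S \<mu> (A i)" .
    qed auto
    finally show "?v P \<le> (\<Sum>i. variation S \<mu> (A i))" .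
  qed
qed

definition variation_measure :: "'a set \<Rightarrow> 'a set set \<Rightarrow> ('a set \<Rightarrow> 'b::real_normed_vector) \<Rightarrow> 'a measure" where
  "variation_measure \<Omega> S \<mu> = measure_of \<Omega> S (variation S \<mu>)"

lemma variation_measure:
  assumes S: "sigma_algebra \<Omega> S" and mu: "countably_additive_vec S \<mu>"
    and bv: "\<And>P. finite P \<Longrightarrow> P \<subseteq> S \<Longrightarrow> disjoint P \<Longrightarrow> (\<Sum>A\<in>P. norm (\<mu> A)) \<le> C"
  shows "sets (variation_measure \<Omega> S \<mu>) = S" "space (variation_measure \<Omega> S \<mu>) = \<Omega>"
    "finite_measure (variation_measure \<Omega> S \<mu>)"
    "\<And>A. A \<in> S \<Longrightarrow> norm (\<mu> A) \<le> measure (variation_measure \<Omega> S \<mu>) A"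
proof -
  interpret sigma_algebra \<Omega> S by (rule S)
  let ?L = "variation_measure \<Omega> S \<mu>"
  show sets: "sets ?L = S" and space: "space ?L = \<Omega>"
    by (simp_all add: variation_measure_def sets_measure_of_eq space_measure_of_conv)
  have mu0: "\<mu> {} = 0" by (rule countably_additive_vec_empty[OF mu empty_sets])
  have pos: "positive S (variation S \<mu>)"
  proof -
    have "(\<Sum>B\<in>P. ennreal (norm (\<mu> B))) = 0" if "P \<in> subpartitions S {}" for P
      using that mu0 by (intro sum.neutral) (auto simp: subpartitions_def)
    then have "variation S \<mu> {} \<le> 0" unfolding variation_def by (intro SUP_least) auto
    then show ?thesis by (simp add: positive_def)
  qed
  have em: "emeasure ?L A = variation S \<mu> A" if "A \<in> S" for A
    unfolding variation_measure_def
    by (rule emeasure_measure_of_sigma[OF S pos countably_additive_variation[OF S mu] that])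
  have "variation S \<mu> \<Omega> \<le> ennreal C"
    unfolding variation_def
  proof (rule SUP_least)
    fix P assume "P \<in> subpartitions S \<Omega>"
    then have "(\<Sum>A\<in>P. norm (\<mu> A)) \<le> C" by (intro bv) (auto simp: subpartitions_def)
    then show "(\<Sum>A\<in>P. ennreal (norm (\<mu> A))) \<le> ennreal C" by (simp add: ennreal_leI)
  qed
  then have "emeasure ?L (space ?L) < \<infinity>"
    unfolding space em[OF top] by (rule le_less_trans) simp
  then show fm: "finite_measure ?L" by (intro finite_measureI) auto
  interpret L: finite_measure ?L by (rule fm)
  fix A assume A: "A \<in> S"
  have "{A} \<in> subpartitions S A" using A by (auto simp: subpartitions_def)
  then have "ennreal (norm (\<mu> A)) \<le> variation S \<mu> A"
    unfolding variation_def by (rule SUP_upper2) auto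
  then show "norm (\<mu> A) \<le> measure ?L A"
    unfolding em[OF A, symmetric] L.emeasure_eq_measure by simp
qed

section \<open>Densities with respect to the variation\<close>

text \<open>Adding \<open>M\<close> to the signed measure \<open>\<nu>\<close> gives a positive measure that is absolutely continuous with
respect to \<open>M\<close>. Its Radon--Nikodym derivative minus \<open>1\<close> is the density of \<open>\<nu>\<close>.\<close>
lemma (in finite_measure) real_density_exists:
  fixes \<nu> :: "'a set \<Rightarrow> real"
  assumes nu: "countably_additive_vec (sets M) \<nu>"
    and le: "\<And>A. A \<in> sets M \<Longrightarrow> \<bar>\<nu> A\<bar> \<le> measure M A"
  obtains f where "integrable M f" "\<And>A. A \<in> sets M \<Longrightarrow> \<nu> A = (\<integral>x\<in>A. f x \<partial>M)"
proof -
  let ?k = "\<lambda>A. measure M A + \<nu> A"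
  have k0: "0 \<le> ?k A" if "A \<in> sets M" for A using le[OF that] by linarith
  define N where "N = measure_of (space M) (sets M) (\<lambda>A. ennreal (?k A))"
  have setsN: "sets N = sets M" "space N = space M"
    by (simp_all add: N_def sets.sets_measure_of_eq space_measure_of_conv)
  have nu0: "\<nu> {} = 0" using le[of "{}"] by auto
  have emN: "emeasure N A = ennreal (?k A)" if "A \<in> sets M" for A
    unfolding N_def
  proof (rule emeasure_measure_of_sigma[OF _ _ _ that])
    show "sigma_algebra (space M) (sets M)" ..
    show "positive (sets M) (\<lambda>A. ennreal (?k A))" by (simp add: positive_def nu0)
    show "countably_additive (sets M) (\<lambda>A. ennreal (?k A))"
      unfolding countably_additive_def
    proof (intro allI impI)
      fix A :: "nat \<Rightarrow> 'a set"
      assume A: "range A \<subseteq> sets M" "disjoint_family A" "(\<Union>i. A i) \<in> sets M"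
      have "(\<lambda>i. ?k (A i)) sums ?k (\<Union>i. A i)"
        using nu A unfolding countably_additive_vec_def
        by (intro sums_add finite_measure_UNION) auto
      then show "(\<Sum>i. ennreal (?k (A i))) = ennreal (?k (\<Union>i. A i))"
        using A by (intro suminf_ennreal_eq) (auto intro!: k0)
    qed
  qed
  have "absolutely_continuous M N"
    unfolding absolutely_continuous_def
  proof
    fix A assume A: "A \<in> null_sets M"
    then have "measure M A = 0" "A \<in> sets M" by (auto simp: measure_eq_0_null_sets)
    then have "emeasure N A = 0" using emN[of A] le[of A] by auto
    then show "A \<in> null_sets N" using \<open>A \<in> sets M\<close> setsN by auto
  qed
  from Radon_Nikodym[OF this setsN(1)] obtain g
    where g[measurable]: "g \<in> borel_measurable M" and dens: "density M g = N" by blast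
  have gint: "(\<integral>\<^sup>+x. g x * indicator A x \<partial>M) = ennreal (?k A)" if "A \<in> sets M" for A
    using emeasure_density[OF g that] dens emN[OF that] by simp
  have "(\<integral>\<^sup>+x. g x \<partial>M) = (\<integral>\<^sup>+x. g x * indicator (space M) x \<partial>M)"
    by (intro nn_integral_cong) auto
  then have fin: "(\<integral>\<^sup>+x. g x \<partial>M) \<noteq> \<infinity>" using gint[of "space M"] by simp
  then have "AE x in M. g x \<noteq> \<infinity>" by (rule nn_integral_PInf_AE[OF g])
  then have ae: "AE x in M. ennreal (enn2real (g x)) = g x" by eventually_elim (auto simp: less_top)
  define h where "h x = enn2real (g x)" for x
  have hm[measurable]: "h \<in> borel_measurable M" unfolding h_def by measurable
  have hi: "integrable M h"
  proof (rule integrableI_nonneg)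
    show "AE x in M. 0 \<le> h x" by (auto simp: h_def)
    have "(\<integral>\<^sup>+x. ennreal (h x) \<partial>M) = (\<integral>\<^sup>+x. g x \<partial>M)"
      using ae by (intro nn_integral_cong_AE) (auto simp: h_def)
    then show "(\<integral>\<^sup>+x. ennreal (h x) \<partial>M) < \<infinity>" using fin by (simp add: less_top)
  qed simp
  show ?thesis
  proof
    show "integrable M (\<lambda>x. h x - 1)" using hi by auto
    fix A assume A: "A \<in> sets M"
    have hA: "integrable M (\<lambda>x. indicator A x *\<^sub>R h x)"
      using A hi by (rule integrable_mult_indicator)
    have iA: "integrable M (indicator A :: 'a \<Rightarrow> real)"
      using A by (intro integrable_real_indicator) (auto simp: less_top[symmetric])
    have "ennreal (\<integral>x\<in>A. h x \<partial>M) = (\<integral>\<^sup>+x. ennreal (indicator A x *\<^sub>R h x) \<partial>M)"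
      unfolding set_lebesgue_integral_def
      by (rule nn_integral_eq_integral[symmetric, OF hA]) (simp add: h_def)
    also have "\<dots> = (\<integral>\<^sup>+x. g x * indicator A x \<partial>M)"
      using ae by (intro nn_integral_cong_AE, eventually_elim) (auto simp: h_def indicator_def)
    finally have "ennreal (\<integral>x\<in>A. h x \<partial>M) = ennreal (?k A)" using gint[OF A] by simp
    moreover have "0 \<le> (\<integral>x\<in>A. h x \<partial>M)"
      unfolding set_lebesgue_integral_def by (intro integral_nonneg_AE) (auto simp: h_def)
    ultimately have "(\<integral>x\<in>A. h x \<partial>M) = ?k A" using k0[OF A] by simp
    moreover have "(\<integral>x\<in>A. (h x - 1) \<partial>M) = (\<integral>x\<in>A. h x \<partial>M) - (\<integral>x\<in>A. 1 \<partial>M)"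
      using hA iA by (intro set_integral_diff) (simp_all add: set_integrable_def)
    moreover have "(\<integral>x\<in>A. 1 \<partial>M) = measure M A"
      using A by (simp add: set_lebesgue_integral_def)
    ultimately show "\<nu> A = (\<integral>x\<in>A. (h x - 1) \<partial>M)" by simp
  qed
qed

lemma (in finite_measure) vector_density_exists:
  fixes \<nu> :: "'a set \<Rightarrow> 'b::euclidean_space"
  assumes nu: "countably_additive_vec (sets M) \<nu>"
    and le: "\<And>A. A \<in> sets M \<Longrightarrow> norm (\<nu> A) \<le> measure M A"
  obtains f where "integrable M f" "\<And>A. A \<in> sets M \<Longrightarrow> \<nu> A = (\<integral>x\<in>A. f x \<partial>M)"
proof -
  have "\<exists>f. integrable M f \<and> (\<forall>A\<in>sets M. \<nu> A \<bullet> b = (\<integral>x\<in>A. f x \<partial>M))" if b: "b \<in> Basis" for b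
  proof -
    have "countably_additive_vec (sets M) (\<lambda>A. \<nu> A \<bullet> b)"
      using nu unfolding countably_additive_vec_def
      by (auto intro: bounded_linear.sums[OF bounded_linear_inner_left])
    moreover have "\<bar>\<nu> A \<bullet> b\<bar> \<le> measure M A" if "A \<in> sets M" for A
      using Basis_le_norm[OF b, of "\<nu> A"] le[OF that] by linarith
    ultimately show ?thesis using real_density_exists[of "\<lambda>A. \<nu> A \<bullet> b"] by metis
  qed
  then obtain f where f: "\<And>b. b \<in> Basis \<Longrightarrow> integrable M (f b)"
    "\<And>b A. b \<in> Basis \<Longrightarrow> A \<in> sets M \<Longrightarrow> \<nu> A \<bullet> b = (\<integral>x\<in>A. f b x \<partial>M)"
    by metis
  show ?thesis
  proof
    show "integrable M (\<lambda>x. \<Sum>b\<in>Basis. f b x *\<^sub>R b)" using f(1) by auto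
    fix A assume A: "A \<in> sets M"
    have "(\<integral>x\<in>A. (\<Sum>b\<in>Basis. f b x *\<^sub>R b) \<partial>M) = (\<integral>x. (\<Sum>b\<in>Basis. (indicator A x *\<^sub>R f b x) *\<^sub>R b) \<partial>M)"
      by (simp add: set_lebesgue_integral_def scaleR_sum_right)
    also have "\<dots> = (\<Sum>b\<in>Basis. (\<integral>x\<in>A. f b x \<partial>M) *\<^sub>R b)"
      unfolding set_lebesgue_integral_def
      using integrable_mult_indicator[OF A f(1)]
      by (subst Bochner_Integration.integral_sum) auto
    also have "\<dots> = \<nu> A" using f(2) A by (simp flip: f(2) add: euclidean_representation)
    finally show "\<nu> A = (\<integral>x\<in>A. (\<Sum>b\<in>Basis. f b x *\<^sub>R b) \<partial>M)" by simp
  qed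
qed

text \<open>If no value \<open>a \<noteq> 0\<close> were essential, every such \<open>a\<close> would have a ball around it whose preimage in \<open>E\<close>
is null. By the Lindelof property countably many of these balls cover all nonzero values, so \<open>f\<close>
would vanish almost everywhere on \<open>E\<close>.\<close>
lemma (in finite_measure) essential_value_exists:
  fixes f :: "'a \<Rightarrow> 'b::euclidean_space"
  assumes f: "integrable M f" and E: "E \<in> sets M" and nz: "(\<integral>x\<in>E. f x \<partial>M) \<noteq> 0"
  obtains a where "a \<noteq> 0" "\<And>r. r > 0 \<Longrightarrow> 0 < measure M {x\<in>E. norm (f x - a) < r}"
proof -
  have fm[measurable]: "f \<in> borel_measurable M" using f by auto
  note E[measurable]
  have "\<exists>a. a \<noteq> 0 \<and> (\<forall>r>0. 0 < measure M {x\<in>E. norm (f x - a) < r})"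
  proof (rule ccontr)
    assume "\<not> ?thesis"
    then have "\<forall>a\<in>-{0}. \<exists>r>0. measure M {x\<in>E. norm (f x - a) < r} = 0"
      by (metis ComplD insertI1 measure_nonneg less_eq_real_def)
    then obtain r where r: "\<And>a. a \<noteq> 0 \<Longrightarrow> r a > 0"
      "\<And>a. a \<noteq> 0 \<Longrightarrow> measure M {x\<in>E. norm (f x - a) < r a} = 0"
      by (metis ComplI singletonD)
    obtain \<F> where \<F>: "\<F> \<subseteq> (\<lambda>a. ball a (r a)) ` (-{0})" "countable \<F>"
      "\<Union>\<F> = \<Union>((\<lambda>a. ball a (r a)) ` (-{0}))"
      by (rule Lindelof[of "(\<lambda>a. ball a (r a)) ` (-{0})"]) auto
    have cov: "f x \<in> \<Union>\<F>" if "f x \<noteq> 0" for x using that r(1)[of "f x"]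
      unfolding \<F>(3) by (intro UnionI[of "ball (f x) (r (f x))"]) auto
    have "(\<Union>B\<in>\<F>. {x\<in>E. f x \<in> B}) \<in> null_sets M"
    proof (rule null_sets_UN'[OF \<F>(2)])
      fix B assume "B \<in> \<F>"
      then obtain a where a: "a \<noteq> 0" "B = ball a (r a)" using \<F>(1) by auto
      have "{x\<in>E. f x \<in> B} = {x\<in>E. norm (f x - a) < r a}"
        by (auto simp: a dist_norm norm_minus_commute)
      moreover have "{x\<in>E. norm (f x - a) < r a} \<in> sets M"
      proof -
        have "{x\<in>E. norm (f x - a) < r a} = E \<inter> {x\<in>space M. norm (f x - a) < r a}"
          using sets.sets_into_space[OF E] by auto
        then show ?thesis by simp
      qed
      ultimately show "{x\<in>E. f x \<in> B} \<in> null_sets M"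
        using r(2)[OF a(1)] by (auto simp: emeasure_eq_measure)
    qed
    then have "AE x in M. x \<notin> (\<Union>B\<in>\<F>. {x\<in>E. f x \<in> B})" by (rule AE_not_in)
    then have "AE x in M. indicator E x *\<^sub>R f x = 0"
      by eventually_elim (use cov in \<open>auto simp: indicator_def\<close>)
    then have "(\<integral>x\<in>E. f x \<partial>M) = (\<integral>x. 0 \<partial>M)"
      unfolding set_lebesgue_integral_def by (intro integral_cong_AE) auto
    then show False using nz by simp
  qed
  then show ?thesis using that by blast
qed

section \<open>Finite measures on path spaces\<close>

text \<open>The sets that can be approximated by the algebra form a sigma-algebra: complements have the same
symmetric difference, and a countable union is first truncated to a finite one.\<close>
lemma (in finite_measure) algebra_approximation:
  assumes alg: "algebra (space M) \<A>" and gen: "sets M = sigma_sets (space M) \<A>"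
    and A: "A \<in> sets M" and e: "e > 0"
  shows "\<exists>C\<in>\<A>. measure M (sym_diff A C) < e"
proof -
  interpret algebra "space M" \<A> by (rule alg)
  have sub: "C \<in> sets M" if "C \<in> \<A>" for C using that by (simp add: gen)
  have "A \<in> sigma_sets (space M) \<A>" using A gen by simp
  then show ?thesis using e
  proof (induction arbitrary: e)
    case (Basic a)
    then show ?case by (intro bexI[of _ a]) auto
  next
    case Empty
    then show ?case by (intro bexI[of _ "{}"]) auto
  next
    case (Compl a)
    from Compl.IH[OF Compl.prems] obtain C where C: "C \<in> \<A>" "measure M (sym_diff a C) < e" by blast
    have "a \<subseteq> space M" using Compl.hyps gen sets.sets_into_space by blast
    then have "sym_diff (space M - a) (space M - C) = sym_diff a C"
      using sets.sets_into_space[OF sub[OF C(1)]] by blast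
    then show ?case using C by (intro bexI[of _ "space M - C"]) auto
  next
    case (Union a)
    have a: "a i \<in> sets M" for i using Union.hyps gen by auto
    have "(\<lambda>n. measure M (\<Union>i<n. a i)) \<longlonglongrightarrow> measure M (\<Union>n. \<Union>i<n. a i)"
      using a by (intro finite_Lim_measure_incseq) (auto simp: incseq_def intro: less_le_trans)
    moreover have "(\<Union>n. \<Union>i<n. a i) = (\<Union>i. a i)" by auto
    ultimately have lim: "(\<lambda>n. measure M (\<Union>i<n. a i)) \<longlonglongrightarrow> measure M (\<Union>i. a i)" by simp
    from order_tendstoD(1)[OF lim, of "measure M (\<Union>i. a i) - e / 2"] \<open>e > 0\<close>
    obtain n where n: "measure M (\<Union>i. a i) - e / 2 < measure M (\<Union>i<n. a i)"
      by (auto simp: eventually_sequentially)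
    have "0 < e / (2 * (real n + 1))" using \<open>e > 0\<close> by simp
    then have "\<forall>i. \<exists>C\<in>\<A>. measure M (sym_diff (a i) C) < e / (2 * (real n + 1))"
      using Union.IH by blast
    then obtain C where C: "\<And>i. C i \<in> \<A>"
      "\<And>i. measure M (sym_diff (a i) (C i)) < e / (2 * (real n + 1))" by metis
    let ?D = "\<Union>i<n. C i"
    have D: "?D \<in> \<A>" using C(1) by (intro finite_UN) auto
    have Cs: "C i \<in> sets M" for i using C(1) sub by blast
    have "measure M (sym_diff (\<Union>i. a i) ?D) \<le>
        measure M (((\<Union>i. a i) - (\<Union>i<n. a i)) \<union> (\<Union>i<n. sym_diff (a i) (C i)))"
      using a Cs by (intro finite_measure_mono) auto
    also have "\<dots> \<le> measure M ((\<Union>i. a i) - (\<Union>i<n. a i)) + measure M (\<Union>i<n. sym_diff (a i) (C i))"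
      using a Cs by (intro measure_Un_le) auto
    also have "measure M ((\<Union>i. a i) - (\<Union>i<n. a i)) = measure M (\<Union>i. a i) - measure M (\<Union>i<n. a i)"
      using a by (intro finite_measure_Diff) auto
    also have "measure M (\<Union>i<n. sym_diff (a i) (C i)) \<le> (\<Sum>i<n. measure M (sym_diff (a i) (C i)))"
      using a Cs by (intro measure_UNION_le) auto
    also have "\<dots> \<le> (\<Sum>i<n. e / (2 * (real n + 1)))" by (intro sum_mono less_imp_le C(2))
    also have "\<dots> \<le> e / 2" using \<open>e > 0\<close> by (simp add: field_simps)
    finally have "measure M (sym_diff (\<Union>i. a i) ?D) < e" using n by linarith
    then show ?case using D by blast
  qed
qed

text \<open>The paths of a tree, seen as sequences of nodes: a node determines all its predecessors.\<close>
locale path_space =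
  fixes \<Omega> :: "(nat \<Rightarrow> 'v) set"
  assumes coherent: "x \<in> \<Omega> \<Longrightarrow> y \<in> \<Omega> \<Longrightarrow> x n = y n \<Longrightarrow> k \<le> n \<Longrightarrow> x k = y k"
    and finite_levels: "finite ((\<lambda>x. x n) ` \<Omega>)"
begin

definition cyl :: "nat \<Rightarrow> (nat \<Rightarrow> 'v) \<Rightarrow> (nat \<Rightarrow> 'v) set" where
  "cyl n x = {y \<in> \<Omega>. y n = x n}"

text \<open>The unions of cylinders of one level. The condition is imposed on all levels \<open>n \<ge> N\<close>, so that the
level may be raised freely when two such sets are combined.\<close>
definition level_sets :: "(nat \<Rightarrow> 'v) set set" where
  "level_sets = {C. C \<subseteq> \<Omega> \<and> (\<exists>N. \<forall>x\<in>C. \<forall>n\<ge>N. cyl n x \<subseteq> C)}"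

lemma algebra_level_sets: "algebra \<Omega> level_sets"
  unfolding algebra_iff_Un
proof (intro conjI ballI)
  show "level_sets \<subseteq> Pow \<Omega>" "{} \<in> level_sets" by (auto simp: level_sets_def)
  fix C assume C: "C \<in> level_sets"
  then obtain N where N: "\<And>x n. x \<in> C \<Longrightarrow> n \<ge> N \<Longrightarrow> cyl n x \<subseteq> C" unfolding level_sets_def by blast
  have "cyl n x \<subseteq> \<Omega> - C" if "x \<in> \<Omega> - C" "n \<ge> N" for x n
    using that N[of _ n] by (fastforce simp: cyl_def)
  then show "\<Omega> - C \<in> level_sets" unfolding level_sets_def by blast
  fix D assume D: "D \<in> level_sets"
  then obtain N' where N': "\<And>x n. x \<in> D \<Longrightarrow> n \<ge> N' \<Longrightarrow> cyl n x \<subseteq> D" unfolding level_sets_def by blast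
  have "cyl n x \<subseteq> C \<union> D" if "x \<in> C \<union> D" "n \<ge> max N N'" for x n
    using that N N' by (metis UnE le_supI1 le_supI2 max.bounded_iff)
  moreover have "C \<union> D \<subseteq> \<Omega>" using C D by (auto simp: level_sets_def)
  ultimately show "C \<union> D \<in> level_sets" unfolding level_sets_def by blast
qed

lemma cyl_eq: "x \<in> \<Omega> \<Longrightarrow> y \<in> cyl n x \<Longrightarrow> k \<le> n \<Longrightarrow> cyl k y = cyl k x"
  using coherent[of y x n k] by (auto simp: cyl_def)

lemma cyl_level_set: "x \<in> \<Omega> \<Longrightarrow> cyl n x \<in> level_sets"
proof -
  assume x: "x \<in> \<Omega>"
  have "cyl k y \<subseteq> cyl n x" if "y \<in> cyl n x" "k \<ge> n" for y k
    using that coherent[of _ y k n] by (auto simp: cyl_def)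
  then show ?thesis unfolding level_sets_def by (auto simp: cyl_def)
qed

lemma countable_cyls: "countable {cyl n x |n x. x \<in> \<Omega>}"
proof -
  have "{cyl n x |n x. x \<in> \<Omega>} \<subseteq> (\<Union>n. (\<lambda>v. {y \<in> \<Omega>. y n = v}) ` (\<lambda>x. x n) ` \<Omega>)"
    by (auto simp: cyl_def)
  moreover have "countable (\<Union>n. (\<lambda>v. {y \<in> \<Omega>. y n = v}) ` (\<lambda>x. x n) ` \<Omega>)"
    by (rule countable_UN) (auto intro: countable_image[OF countable_finite[OF finite_levels]])
  ultimately show ?thesis by (rule countable_subset)
qed

lemma cyl_subset: "cyl n x \<subseteq> \<Omega>" and cyl_self: "x \<in> \<Omega> \<Longrightarrow> x \<in> cyl n x"
  by (auto simp: cyl_def)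

end

locale path_measure = path_space \<Omega> + finite_measure M
  for \<Omega> :: "(nat \<Rightarrow> 'v) set" and M :: "(nat \<Rightarrow> 'v) measure" +
  assumes space_M: "space M = \<Omega>" and sets_M: "sets M = sigma_sets \<Omega> level_sets"
begin

lemma cyl_sets: "x \<in> \<Omega> \<Longrightarrow> cyl n x \<in> sets M"
  unfolding sets_M by (intro sigma_sets.Basic cyl_level_set)

text \<open>Two cylinders are either nested or disjoint, so the bad cylinders that come first along each path
are pairwise disjoint. In the tree this selection plays the role of a Vitali covering.\<close>
lemma first_bad_cylinders:
  fixes N :: nat and D :: "(nat \<Rightarrow> 'v) set" and bad :: "(nat \<Rightarrow> 'v) set \<Rightarrow> bool"
  assumes D: "D \<subseteq> \<Omega>" "\<And>x n. x \<in> D \<Longrightarrow> n \<ge> N \<Longrightarrow> cyl n x \<subseteq> D"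
  defines "B \<equiv> {x\<in>D. \<exists>n\<ge>N. bad (cyl n x)}"
  shows "\<exists>\<D>. countable \<D> \<and> disjoint \<D> \<and> \<Union>\<D> = B \<and> \<D> \<subseteq> sets M \<and> (\<forall>Q\<in>\<D>. bad Q)"
proof -
  define first where "first x = (LEAST n. n \<ge> N \<and> bad (cyl n x))" for x
  define \<D> where "\<D> = (\<lambda>x. cyl (first x) x) ` B"
  have B: "B \<subseteq> \<Omega>" using D(1) by (auto simp: B_def)
  have first: "first x \<ge> N \<and> bad (cyl (first x) x)" if "x \<in> B" for x
  proof -
    from that have "\<exists>n. n \<ge> N \<and> bad (cyl n x)" unfolding B_def by blast
    then show ?thesis
      unfolding first_def by (rule LeastI_ex[of "\<lambda>n. n \<ge> N \<and> bad (cyl n x)"])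
  qed
  have first_le: "first x \<le> n" if "n \<ge> N" "bad (cyl n x)" for x n
    unfolding first_def
    by (rule Least_le[of "\<lambda>n. n \<ge> N \<and> bad (cyl n x)"]) (use that in blast)
  have *: "cyl (first x) x = cyl (first y) y"
    if xy: "x \<in> B" "y \<in> B" and z: "z \<in> cyl (first x) x" "z \<in> cyl (first y) y"
      and le: "first x \<le> first y" for x y z
  proof -
    have "cyl (first x) x = cyl (first x) z" using cyl_eq[OF _ z(1)] xy B by auto
    also have "\<dots> = cyl (first x) y" using cyl_eq[OF _ z(2) le] xy B by auto
    finally have eq: "cyl (first x) x = cyl (first x) y" .
    then have "first y \<le> first x" using first[OF xy(1)] by (intro first_le) auto
    then show ?thesis using eq le by auto
  qed
  show ?thesis
  proof (intro exI[of _ \<D>] conjI ballI)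
    show "countable \<D>"
      using B by (intro countable_subset[OF _ countable_cyls]) (auto simp: \<D>_def)
    show "disjoint \<D>"
      unfolding disjoint_def
    proof (intro ballI impI)
      fix P Q assume PQ: "P \<in> \<D>" "Q \<in> \<D>" "P \<noteq> Q"
      then obtain x y where xy: "x \<in> B" "y \<in> B" "P = cyl (first x) x" "Q = cyl (first y) y"
        by (auto simp: \<D>_def)
      show "P \<inter> Q = {}"
      proof (rule ccontr)
        assume "P \<inter> Q \<noteq> {}"
        then obtain z where "z \<in> P" "z \<in> Q" by blast
        then have "P = Q" using *[of x y z] *[of y x z] xy by (cases "first x \<le> first y") auto
        then show False using PQ(3) by simp
      qed
    qed
    show "\<D> \<subseteq> sets M" using B by (auto simp: \<D>_def intro!: cyl_sets)
    show "bad Q" if "Q \<in> \<D>" for Q using that first by (auto simp: \<D>_def)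
    show "\<Union>\<D> = B"
    proof
      show "B \<subseteq> \<Union>\<D>" using B cyl_self by (fastforce simp: \<D>_def)
      show "\<Union>\<D> \<subseteq> B"
      proof
        fix y assume "y \<in> \<Union>\<D>"
        then obtain x where x: "x \<in> B" "y \<in> cyl (first x) x" by (auto simp: \<D>_def)
        then have "y \<in> D" using D(2)[of x "first x"] first[of x] by (auto simp: B_def)
        moreover have "cyl (first x) y = cyl (first x) x" using cyl_eq[OF _ x(2)] x(1) B by auto
        ultimately show "y \<in> B" using first[OF x(1)] unfolding B_def by auto
      qed
    qed
  qed
qed

text \<open>Lebesgue density, in the form of a weak type estimate for the maximal function. The function \<open>h\<close> is at
most \<open>e\<close> on \<open>A\<close>. Let \<open>C\<close> be a union of cylinders of some level \<open>N\<close> that approximates \<open>A\<close>, and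
let \<open>B\<close> be the union of the cylinders inside \<open>C\<close>, of level at least \<open>N\<close>, on which the
mean of \<open>h\<close> exceeds \<open>2 * e\<close>. Then the integral of \<open>h\<close> over \<open>B\<close> is at least \<open>2 * e\<close> times the
mass of \<open>B\<close>, and the points of \<open>A\<close> account for at most half of this value. The rest comes from
\<open>C - A\<close>, where \<open>h\<close> has a small integral. So \<open>B\<close> is small, and \<open>A \<inter> C - B\<close> is left.\<close>
lemma density_points:
  fixes h :: "(nat \<Rightarrow> 'v) \<Rightarrow> real"
  assumes h: "integrable M h" and h0: "\<And>x. 0 \<le> h x"
    and A: "A \<in> sets M" "0 < measure M A" and e: "0 < e" and hA: "\<And>x. x \<in> A \<Longrightarrow> h x \<le> e"
  obtains A' N where "A' \<in> sets M" "A' \<subseteq> A" "0 < measure M A'"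
    "\<And>x n. x \<in> A' \<Longrightarrow> n \<ge> N \<Longrightarrow> (\<integral>y\<in>cyl n x. h y \<partial>M) \<le> 2 * e * measure M (cyl n x)"
proof -
  have [measurable]: "h \<in> borel_measurable M" using h by auto
  define \<rho> where "\<rho> = density M (\<lambda>x. ennreal (h x))"
  \<comment> \<open>Approximation with respect to \<open>\<sigma>\<close> controls both the mass and the integral of \<open>h\<close>.\<close>
  define \<sigma> where "\<sigma> = density M (\<lambda>x. ennreal (1 + h x))"
  have sets_eq: "sets \<rho> = sets M" "sets \<sigma> = sets M" "space \<sigma> = space M" by (simp_all add: \<rho>_def \<sigma>_def)
  have dens: "emeasure (density M (\<lambda>x. ennreal (k x))) X = ennreal (\<integral>x\<in>X. k x \<partial>M)"
    if "integrable M k" "\<And>x. 0 \<le> k x" "X \<in> sets M" for k X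
  proof -
    have "emeasure (density M (\<lambda>x. ennreal (k x))) X = (\<integral>\<^sup>+x. ennreal (indicator X x *\<^sub>R k x) \<partial>M)"
      using that by (subst emeasure_density) (auto intro!: nn_integral_cong simp: indicator_def)
    also have "\<dots> = ennreal (\<integral>x\<in>X. k x \<partial>M)"
      unfolding set_lebesgue_integral_def
      using that by (intro nn_integral_eq_integral integrable_mult_indicator) auto
    finally show ?thesis .
  qed
  have em\<rho>: "emeasure \<rho> X = ennreal (\<integral>x\<in>X. h x \<partial>M)" if "X \<in> sets M" for X
    unfolding \<rho>_def by (rule dens[OF h h0 that])
  have hX: "integrable M (\<lambda>x. indicator X x *\<^sub>R h x)" if "X \<in> sets M" for X
    using that h by (rule integrable_mult_indicator)
  have iX: "integrable M (indicator X :: _ \<Rightarrow> real)" if "X \<in> sets M" for X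
    using that by (intro integrable_real_indicator) (auto simp: less_top[symmetric])
  have nonneg: "0 \<le> (\<integral>x\<in>X. h x \<partial>M)" for X
    unfolding set_lebesgue_integral_def using h0 by (intro integral_nonneg_AE) auto
  have em\<sigma>: "emeasure \<sigma> X = ennreal (measure M X + (\<integral>x\<in>X. h x \<partial>M))" if X: "X \<in> sets M" for X
  proof -
    have "emeasure \<sigma> X = ennreal (\<integral>x\<in>X. (1 + h x) \<partial>M)"
      unfolding \<sigma>_def using h h0 by (intro dens X) (auto intro: add_nonneg_nonneg)
    also have "(\<integral>x\<in>X. (1 + h x) \<partial>M) = (\<integral>x\<in>X. 1 \<partial>M) + (\<integral>x\<in>X. h x \<partial>M)"
      using hX[OF X] iX[OF X] by (intro set_integral_add) (auto simp: set_integrable_def)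
    also have "(\<integral>x\<in>X. 1 \<partial>M) = measure M X" using X by (simp add: set_lebesgue_integral_def)
    finally show ?thesis .
  qed
  interpret \<sigma>: finite_measure \<sigma>
    using em\<sigma>[OF sets.top] by (intro finite_measureI) (simp add: sets_eq)
  have m\<sigma>: "measure \<sigma> X = measure M X + (\<integral>x\<in>X. h x \<partial>M)" if "X \<in> sets M" for X
    using em\<sigma>[OF that] nonneg[of X] unfolding measure_def[of \<sigma>] by (simp del: ennreal_plus)
  define \<eta> where "\<eta> = min (measure M A / 4) (e * measure M A / 4)"
  have \<eta>: "\<eta> > 0" using A e by (simp add: \<eta>_def)
  obtain C where C: "C \<in> level_sets" "measure \<sigma> (sym_diff A C) < \<eta>"
    using \<sigma>.algebra_approximation[of level_sets A \<eta>] algebra_level_sets A \<eta>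
    by (auto simp: sets_eq space_M sets_M)
  then obtain N where N: "C \<subseteq> \<Omega>" "\<And>x n. x \<in> C \<Longrightarrow> n \<ge> N \<Longrightarrow> cyl n x \<subseteq> C"
    unfolding level_sets_def by blast
  have Cs: "C \<in> sets M" unfolding sets_M using C(1) by blast
  define bad where "bad Q \<longleftrightarrow> 2 * e * measure M Q < (\<integral>x\<in>Q. h x \<partial>M)" for Q
  obtain \<D> where \<D>: "countable \<D>" "disjoint \<D>" "\<Union>\<D> = {x\<in>C. \<exists>n\<ge>N. bad (cyl n x)}"
    "\<D> \<subseteq> sets M" "\<And>Q. Q \<in> \<D> \<Longrightarrow> bad Q"
    using first_bad_cylinders[where D = C and N = N and bad = bad, OF N(1)] N(2) by meson
  define B where "B = \<Union>\<D>"
  have Bs: "B \<in> sets M" unfolding B_def using \<D> by (intro sets.countable_Union) auto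
  have Ss: "sym_diff A C \<in> sets M" using A Cs by auto
  have BC: "B \<subseteq> C" unfolding B_def \<D>(3) by auto
  have disj: "disjoint_family_on (\<lambda>Q. Q) \<D>"
    using \<D>(2) by (auto simp: disjoint_family_on_def disjoint_def)
  have emB: "emeasure K B = (\<integral>\<^sup>+Q. emeasure K Q \<partial>count_space \<D>)"
    if "sets K = sets M" for K :: "(nat \<Rightarrow> 'v) measure"
    using emeasure_UN_countable[of \<D> "\<lambda>Q. Q" K] \<D>(1,4) disj that by (simp add: B_def subset_iff)
  have "ennreal (2 * e) * emeasure M B = (\<integral>\<^sup>+Q. ennreal (2 * e) * emeasure M Q \<partial>count_space \<D>)"
    by (simp add: emB nn_integral_cmult)
  also have "\<dots> \<le> (\<integral>\<^sup>+Q. emeasure \<rho> Q \<partial>count_space \<D>)"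
  proof (intro nn_integral_mono)
    fix Q assume "Q \<in> space (count_space \<D>)"
    then have Q: "Q \<in> \<D>" "Q \<in> sets M" using \<D>(4) by auto
    then show "ennreal (2 * e) * emeasure M Q \<le> emeasure \<rho> Q"
      using \<D>(5)[OF Q(1)] e em\<rho>[OF Q(2)]
      by (auto simp: bad_def emeasure_eq_measure ennreal_mult[symmetric] intro!: ennreal_leI)
  qed
  also have "\<dots> = emeasure \<rho> B"
    by (simp add: emB sets_eq)
  finally have "2 * e * measure M B \<le> (\<integral>x\<in>B. h x \<partial>M)"
    using em\<rho>[OF Bs] nonneg[of B] e
    by (simp add: emeasure_eq_measure ennreal_mult[symmetric])
  also have "(\<integral>x\<in>B. h x \<partial>M) \<le> (\<integral>x. e * indicator B x + indicator (sym_diff A C) x *\<^sub>R h x \<partial>M)"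
    unfolding set_lebesgue_integral_def
  proof (intro integral_mono)
    show "integrable M (\<lambda>x. e * indicator B x + indicator (sym_diff A C) x *\<^sub>R h x)"
      by (intro Bochner_Integration.integrable_add integrable_mult_right iX hX Bs Ss)
    show "indicator B x *\<^sub>R h x \<le> e * indicator B x + indicator (sym_diff A C) x *\<^sub>R h x" for x
    proof (cases "x \<in> A")
      case True
      then have "indicator B x * h x \<le> e * indicator B x"
        using hA[OF True] by (auto simp: indicator_def)
      moreover have "0 \<le> indicator (sym_diff A C) x * h x" using h0[of x] by (auto simp: indicator_def)
      ultimately show ?thesis by simp
    next
      case False
      then show ?thesis using BC h0[of x] e by (auto simp: indicator_def)
    qed
  qed (rule hX[OF Bs])
  also have "\<dots> = e * measure M B + (\<integral>x\<in>sym_diff A C. h x \<partial>M)"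
    unfolding set_lebesgue_integral_def
    using hX[OF Ss] iX[OF Bs] Bs by (subst Bochner_Integration.integral_add) auto
  also have "(\<integral>x\<in>sym_diff A C. h x \<partial>M) \<le> \<eta>"
    using C(2) m\<sigma>[OF Ss] measure_nonneg[of M "sym_diff A C"] by linarith
  finally have "e * measure M B \<le> \<eta>" by simp
  also have "\<eta> \<le> e * (measure M A / 4)" by (simp add: \<eta>_def)
  finally have mB: "measure M B \<le> measure M A / 4" using e by simp
  have mAC: "measure M (A - C) \<le> measure M A / 4"
  proof -
    have "measure M (A - C) \<le> measure M (sym_diff A C)" using A Cs by (intro finite_measure_mono) auto
    also have "\<dots> \<le> \<eta>" using C(2) m\<sigma>[OF Ss] nonneg[of "sym_diff A C"] by linarith
    finally show ?thesis by (simp add: \<eta>_def)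
  qed
  show ?thesis
  proof
    show "(A \<inter> C) - B \<in> sets M" using A Cs Bs by auto
    have "measure M A \<le> measure M (((A \<inter> C) - B) \<union> (A - C) \<union> B)"
      using A Cs Bs by (intro finite_measure_mono) auto
    also have "\<dots> \<le> measure M (((A \<inter> C) - B) \<union> (A - C)) + measure M B"
      using A Cs Bs by (intro measure_Un_le) auto
    also have "measure M (((A \<inter> C) - B) \<union> (A - C)) \<le> measure M ((A \<inter> C) - B) + measure M (A - C)"
      using A Cs Bs by (intro measure_Un_le) auto
    finally show "0 < measure M ((A \<inter> C) - B)" using mB mAC A by linarith
    fix x n assume "x \<in> (A \<inter> C) - B" "n \<ge> N"
    then have "\<not> bad (cyl n x)" unfolding B_def \<D>(3) by auto
    then show "(\<integral>y\<in>cyl n x. h y \<partial>M) \<le> 2 * e * measure M (cyl n x)" by (simp add: bad_def)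
  qed auto
qed

end

section \<open>The mass distribution principle\<close>

lemma path_dist_eq:
  assumes "x n \<noteq> y n" "\<And>j. j < n \<Longrightarrow> x j = y j"
  shows "path_dist m x y = 1 / real m ^ n"
proof -
  have *: "{k. \<forall>j<k. x j = y j} = {..n}"
    using assms by (auto simp: not_le[symmetric] intro: less_le_trans)
  have "Max {..n} = n" by (rule Max_eqI) auto
  moreover have "x \<noteq> y" using assms(1) by blast
  ultimately show ?thesis by (simp add: path_dist_def *)
qed

lemma path_dist_le_1: "m \<ge> 1 \<Longrightarrow> path_dist m x y \<le> 1"
  by (simp add: path_dist_def)

text \<open>If the paths in \<open>U\<close> branch for the first time at level \<open>n\<close>, then \<open>U\<close> has diameter \<open>m\<close> to the power
\<open>- n\<close> but is only contained in a cylinder of level \<open>n - 1\<close> (in the whole space, if \<open>n = 0\<close>); this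
shift costs the factor \<open>1 / q\<close>.
The set \<open>X\<close> is there because \<open>U\<close> itself may fail to be measurable.\<close>
lemma mass_le_diam_pow:
  fixes \<Omega> :: "(nat \<Rightarrow> 'w set) set"
  assumes pm: "path_measure \<Omega> M" and ms: "Metric_space \<Omega> (path_dist m)" and m: "m \<ge> 2"
    and s: "0 \<le> s" and q: "q = real m powr (- s)"
    and D: "measure M \<Omega> \<le> D" "\<And>n. measure M (path_space.cyl \<Omega> n x) \<le> D * q ^ n"
    and U: "U \<subseteq> \<Omega>" "x \<in> U"
  shows "\<exists>X\<in>sets M. U \<subseteq> X \<and> measure M X \<le> D / q * Metric_space.diam_pow (path_dist m) s U"
proof -
  interpret path_measure \<Omega> M by (rule pm)
  interpret ms: Metric_space \<Omega> "path_dist m" by (rule ms)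
  have D0: "0 \<le> D" using D(1) measure_nonneg[of M \<Omega>] by linarith
  have q01: "0 < q" "q \<le> 1"
    using m s by (auto simp: q powr_minus_divide ge_one_powr_ge_zero)
  have qn: "q ^ n = (1 / real m ^ n) powr s" for n
  proof -
    have "q ^ n = q powr real n" using q01 by (simp add: powr_realpow)
    also have "\<dots> = (real m powr (- real n)) powr s"
      by (simp add: q powr_powr mult.commute)
    also have "real m powr (- real n) = 1 / real m ^ n"
      using m by (simp add: powr_minus_divide powr_realpow)
    finally show ?thesis .
  qed
  have x: "x \<in> \<Omega>" using U by auto
  have all: "measure M \<Omega> \<le> D / q"
  proof -
    have "D * q \<le> D" using q01 D0 by (simp add: mult_left_le)
    then have "D \<le> D / q" using q01 by (simp add: pos_le_divide_eq)
    then show ?thesis using D(1) by linarith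
  qed
  have \<Omega>s: "\<Omega> \<in> sets M" using space_M by auto
  \<comment> \<open>A singleton has no branching point, and for \<open>s = 0\<close> its diameter power is \<open>1\<close> by convention.\<close>
  consider "s = 0" | "s > 0" "U = {x}" | "s > 0" "\<exists>y\<in>U. y \<noteq> x" using s U by force
  then show ?thesis
  proof cases
    case 1
    then show ?thesis using U all \<Omega>s
      by (intro bexI[of _ \<Omega>]) (auto simp: ms.diam_pow_def)
  next
    case 2
    have "q < 1" using m \<open>s > 0\<close> by (simp add: q powr_less_one)
    then have "(\<lambda>n. D * q ^ n) \<longlonglongrightarrow> D * 0"
      using q01 by (intro tendsto_intros LIMSEQ_realpow_zero) auto
    moreover have "measure M {x} \<le> D * q ^ n" for n
    proof -
      have "measure M {x} \<le> measure M (cyl n x)"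
        using cyl_sets[OF x] cyl_self[OF x] by (intro finite_measure_mono) auto
      then show ?thesis using D(2)[of n] by linarith
    qed
    ultimately have "measure M {x} \<le> 0" by (intro LIMSEQ_le_const[of "\<lambda>n. D * q ^ n"]) auto
    moreover have "(\<Inter>n. cyl n x) \<in> sets M" using cyl_sets[OF x] by (intro sets.countable_INT) auto
    moreover have "{x} = (\<Inter>n. cyl n x)" using x by (auto simp: cyl_def)
    moreover have "0 \<le> D / q * ms.diam_pow s U" using D0 q01 by (simp add: ms.diam_pow_def)
    ultimately show ?thesis using 2 by (intro bexI[of _ "{x}"]) auto
  next
    case 3
    let ?P = "\<lambda>n. \<exists>y\<in>U. \<exists>z\<in>U. y n \<noteq> z n"
    define n where "n = (LEAST n. ?P n)"
    from 3 obtain y where "y \<in> U" "y \<noteq> x" by blast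
    then have "\<exists>n. ?P n" using U by (metis ext)
    then have "?P n" unfolding n_def by (rule LeastI_ex)
    then obtain y z where yz: "y \<in> U" "z \<in> U" "y n \<noteq> z n" by blast
    have agree: "y j = z j" if "j < n" "y \<in> U" "z \<in> U" for j y z
      using not_less_Least[of j ?P] that unfolding n_def by blast
    have "path_dist m y z = 1 / real m ^ n"
      by (rule path_dist_eq) (use yz agree in auto)
    moreover have "path_dist m y z \<le> (SUP p\<in>U \<times> U. path_dist m (fst p) (snd p))"
      using yz m path_dist_le_1[of m]
      by (intro cSUP_upper2[of _ _ "(y, z)"] bdd_aboveI[of _ 1]) auto
    ultimately have "(1 / real m ^ n) powr s \<le> (SUP p\<in>U \<times> U. path_dist m (fst p) (snd p)) powr s"
      using s by (intro powr_mono2) auto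
    then have dp: "q ^ n \<le> ms.diam_pow s U" using 3 U qn[of n] by (auto simp: ms.diam_pow_def)
    show ?thesis
    proof (cases n)
      case 0
      have "D / q * 1 \<le> D / q * ms.diam_pow s U"
        using dp 0 D0 q01 by (intro mult_left_mono) auto
      then show ?thesis using U all \<Omega>s by (intro bexI[of _ \<Omega>]) auto
    next
      case (Suc k)
      have "measure M (cyl k x) \<le> D * q ^ k" by (rule D(2))
      also have "\<dots> = D / q * q ^ n" using q01 Suc by simp
      also have "\<dots> \<le> D / q * ms.diam_pow s U" using dp D0 q01 by (intro mult_left_mono) auto
      finally have "measure M (cyl k x) \<le> D / q * ms.diam_pow s U" .
      moreover have "U \<subseteq> cyl k x"
      proof
        fix y assume y: "y \<in> U"
        have "y k = x k" by (rule agree[OF _ y U(2)]) (simp add: Suc)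
        then show "y \<in> cyl k x" using U(1) y by (auto simp: cyl_def)
      qed
      ultimately show ?thesis using cyl_sets[OF x] by blast
    qed
  qed
qed

text \<open>The mass distribution principle: if the masses of the cylinders around the points of \<open>A\<close> decay like
\<open>m powr (- s * n)\<close>, then a cover of \<open>A\<close> has a sum of \<open>s\<close>-th powers of diameters that is bounded
below by a multiple of the mass of \<open>A\<close>.\<close>
lemma hausdorff_measure_nonzero:
  fixes \<Omega> :: "(nat \<Rightarrow> 'w set) set"
  assumes pm: "path_measure \<Omega> M" and ms: "Metric_space \<Omega> (path_dist m)" and m: "m \<ge> 2"
    and s: "0 \<le> s" and q: "q = real m powr (- s)"
    and A: "A \<in> sets M" "0 < measure M A" "A \<subseteq> E"
    and decay: "\<And>x n. x \<in> A \<Longrightarrow> n \<ge> N \<Longrightarrow>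
      measure M (path_space.cyl \<Omega> (Suc n) x) \<le> q * measure M (path_space.cyl \<Omega> n x)"
  shows "Metric_space.hausdorff_measure \<Omega> (path_dist m) s E \<noteq> 0"
proof
  interpret path_measure \<Omega> M by (rule pm)
  interpret ms: Metric_space \<Omega> "path_dist m" by (rule ms)
  assume zero: "ms.hausdorff_measure s E = 0"
  have q01: "0 < q" "q \<le> 1"
    using m s by (auto simp: q powr_minus_divide ge_one_powr_ge_zero)
  have A\<Omega>: "A \<subseteq> \<Omega>" using sets.sets_into_space[OF A(1)] space_M by simp
  have \<Omega>s: "\<Omega> \<in> sets M" using space_M by auto
  have \<Omega>0: "0 < measure M \<Omega>"
    using A finite_measure_mono[OF A\<Omega> \<Omega>s] by linarith
  \<comment> \<open>With this constant the bound \<open>D * q ^ n\<close> is trivial up to level \<open>N\<close>, where the decay starts.\<close>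
  define D where "D = measure M \<Omega> / q ^ N"
  have D0: "0 < D" using \<Omega>0 q01 by (simp add: D_def)
  have D1: "measure M \<Omega> \<le> D * q ^ n" if "n \<le> N" for n
  proof -
    have "q ^ N \<le> q ^ n" using q01 that by (intro power_decreasing) auto
    then have "D * q ^ N \<le> D * q ^ n" using D0 by (intro mult_left_mono) auto
    then show ?thesis using q01 by (simp add: D_def)
  qed
  have cyl_le: "measure M (cyl n x) \<le> D * q ^ n" if x: "x \<in> A" for n x
  proof (induction n)
    case 0
    have "measure M (cyl 0 x) \<le> measure M \<Omega>"
      using cyl_subset \<Omega>s by (intro finite_measure_mono) auto
    then show ?case using D1[of 0] by simp
  next
    case (Suc n)
    show ?case
    proof (cases "n \<ge> N")
      case True
      have "measure M (cyl (Suc n) x) \<le> q * measure M (cyl n x)" by (rule decay[OF x True])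
      also have "\<dots> \<le> q * (D * q ^ n)" using Suc q01 by (intro mult_left_mono) auto
      finally show ?thesis by (simp add: mult_ac)
    next
      case False
      have "measure M (cyl (Suc n) x) \<le> measure M \<Omega>"
        using cyl_subset \<Omega>s by (intro finite_measure_mono) auto
      then show ?thesis using D1[of "Suc n"] False by linarith
    qed
  qed
  define c where "c = D / q"
  have c0: "0 < c" using D0 q01 by (simp add: c_def)
  have "ms.hausdorff_premeasure s 1 E \<le> ms.hausdorff_measure s E"
    unfolding ms.hausdorff_measure_def by (rule SUP_upper) auto
  then have "ms.hausdorff_premeasure s 1 E < ennreal (measure M A / c)"
    using zero A c0 by simp
  then obtain C :: "nat \<Rightarrow> (nat \<Rightarrow> 'w set) set" where C: "E \<subseteq> (\<Union>i. C i)" "\<And>i. C i \<subseteq> \<Omega>"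
    "(\<Sum>i. ennreal (ms.diam_pow s (C i))) < ennreal (measure M A / c)"
    unfolding ms.hausdorff_premeasure_def INF_less_iff by blast
  have "\<exists>X\<in>sets M. C i \<inter> A \<subseteq> X \<and> measure M X \<le> c * ms.diam_pow s (C i)" for i
  proof (cases "C i \<inter> A = {}")
    case True
    have "0 \<le> c * ms.diam_pow s (C i)" using c0 by (simp add: ms.diam_pow_def)
    then show ?thesis using True by (intro bexI[of _ "{}"]) auto
  next
    case False
    then obtain x where x: "x \<in> C i" "x \<in> A" by blast
    have "measure M \<Omega> \<le> D" using D1[of 0] by simp
    from mass_le_diam_pow[OF pm ms m s q this cyl_le[OF x(2)] C(2) x(1)]
    obtain X where "X \<in> sets M" "C i \<subseteq> X" "measure M X \<le> D / q * ms.diam_pow s (C i)" by blast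
    then show ?thesis unfolding c_def by blast
  qed
  then obtain X where X: "\<And>i. X i \<in> sets M" "\<And>i. C i \<inter> A \<subseteq> X i"
    "\<And>i. measure M (X i) \<le> c * ms.diam_pow s (C i)" by metis
  have "A \<subseteq> (\<Union>i. X i)" using A(3) C(1) X(2) by blast
  then have "emeasure M A \<le> emeasure M (\<Union>i. X i)" using X(1) by (intro emeasure_mono) auto
  also have "\<dots> \<le> (\<Sum>i. emeasure M (X i))"
    using X(1) by (intro emeasure_subadditive_countably) auto
  also have "\<dots> \<le> (\<Sum>i. ennreal c * ennreal (ms.diam_pow s (C i)))"
    using X(3) c0 by (intro suminf_le) (auto simp: emeasure_eq_measure ennreal_mult'[symmetric] intro!: ennreal_leI)
  also have "\<dots> = ennreal c * (\<Sum>i. ennreal (ms.diam_pow s (C i)))" by simp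
  also have "\<dots> < ennreal c * ennreal (measure M A / c)"
    using C(3) c0 by (intro ennreal_mult_strict_left_mono) auto
  also have "\<dots> = emeasure M A"
    using c0 by (simp add: emeasure_eq_measure flip: ennreal_mult')
  finally show False by simp
qed

section \<open>Fourier analysis on a self-dual finite group\<close>

locale self_dual_group = comm_group G for G (structure) +
  fixes \<Phi> :: "'g \<Rightarrow> 'g \<Rightarrow> complex"
  assumes fin: "finite (carrier G)" and iso: "\<Phi> \<in> iso G (dual_group G)"
begin

lemma character_hom: "\<gamma> \<in> carrier G \<Longrightarrow> \<Phi> \<gamma> \<in> hom G circle_group"
  using iso by (auto simp: iso_def dual_group_def hom_def bij_betw_def)

lemma character_norm: "\<gamma> \<in> carrier G \<Longrightarrow> z \<in> carrier G \<Longrightarrow> norm (\<Phi> \<gamma> z) = 1"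
  using character_hom[of \<gamma>] by (auto simp: hom_def circle_group_def)

lemma character_mult:
  "\<gamma> \<in> carrier G \<Longrightarrow> z \<in> carrier G \<Longrightarrow> w \<in> carrier G \<Longrightarrow> \<Phi> \<gamma> (z \<otimes> w) = \<Phi> \<gamma> z * \<Phi> \<gamma> w"
  using character_hom[of \<gamma>] by (auto simp: hom_def circle_group_def)

lemma label_mult:
  assumes "\<gamma> \<in> carrier G" "\<delta> \<in> carrier G" "z \<in> carrier G"
  shows "\<Phi> (\<gamma> \<otimes> \<delta>) z = \<Phi> \<gamma> z * \<Phi> \<delta> z"
proof -
  have "\<Phi> (\<gamma> \<otimes> \<delta>) = (\<lambda>z\<in>carrier G. \<Phi> \<gamma> z * \<Phi> \<delta> z)"
    using iso assms unfolding iso_def hom_def by (simp add: dual_group_def)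
  then show ?thesis using assms by simp
qed

lemma character_at_one: "\<gamma> \<in> carrier G \<Longrightarrow> \<Phi> \<gamma> \<one> = 1"
  using character_mult[of \<gamma> \<one> \<one>] character_norm[of \<gamma> \<one>] by auto

lemma trivial_character: "z \<in> carrier G \<Longrightarrow> \<Phi> \<one> z = 1"
  using label_mult[of \<one> \<one> z] character_norm[of \<one> z] by auto

lemma character_cnj_inverse: "\<gamma> \<in> carrier G \<Longrightarrow> z \<in> carrier G \<Longrightarrow> \<Phi> \<gamma> (inv z) = cnj (\<Phi> \<gamma> z)"
  using character_mult[of \<gamma> z "inv z"] character_norm[of \<gamma> z] character_at_one[of \<gamma>]
  by (metis complex_norm_square inv_closed mult.right_neutral mult_cancel_left norm_zero of_real_1 one_power2 r_inv zero_neq_one)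

lemma label_inverse:
  assumes "\<gamma> \<in> carrier G" "z \<in> carrier G" shows "\<Phi> (inv \<gamma>) z = cnj (\<Phi> \<gamma> z)"
  using label_mult[of \<gamma> "inv \<gamma>" z] assms character_norm[of \<gamma> z] trivial_character[of z]
  by (metis complex_norm_square inv_closed mult.right_neutral mult_cancel_left norm_zero of_real_1 one_power2 r_inv zero_neq_one)

lemma label_nontrivial:
  assumes "\<gamma> \<in> carrier G" "\<gamma> \<noteq> \<one>"
  obtains z where "z \<in> carrier G" "\<Phi> \<gamma> z \<noteq> 1"
proof -
  have inj: "inj_on \<Phi> (carrier G)" using iso by (auto simp: iso_def bij_betw_def)
  have ext: "\<Phi> \<delta> \<in> extensional (carrier G)" if "\<delta> \<in> carrier G" for \<delta>
    using iso that by (auto simp: iso_def dual_group_def hom_def)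
  have "\<Phi> \<gamma> \<noteq> \<Phi> \<one>" using inj assms by (auto dest: inj_onD)
  then have "\<exists>z\<in>carrier G. \<Phi> \<gamma> z \<noteq> \<Phi> \<one> z"
    using ext[OF assms(1)] ext[OF one_closed] by (metis extensionalityI)
  then show ?thesis using that trivial_character by auto
qed

lemma sum_translate:
  fixes f :: "'g \<Rightarrow> 'b::comm_monoid_add"
  assumes "a \<in> carrier G"
  shows "(\<Sum>z\<in>carrier G. f (a \<otimes> z)) = (\<Sum>z\<in>carrier G. f z)"
proof (rule sum.reindex_bij_betw)
  show "bij_betw ((\<otimes>) a) (carrier G) (carrier G)"
    using assms by (metis bij_betw_def inj_on_cmult surj_const_mult)
qed

lemma sum_character:
  assumes "\<gamma> \<in> carrier G" "\<gamma> \<noteq> \<one>"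
  shows "(\<Sum>z\<in>carrier G. \<Phi> \<gamma> z) = 0"
proof -
  obtain w where w: "w \<in> carrier G" "\<Phi> \<gamma> w \<noteq> 1" by (rule label_nontrivial[OF assms])
  have "\<Phi> \<gamma> w * (\<Sum>z\<in>carrier G. \<Phi> \<gamma> z) = (\<Sum>z\<in>carrier G. \<Phi> \<gamma> (w \<otimes> z))"
    using w assms by (simp add: sum_distrib_left character_mult)
  also have "\<dots> = (\<Sum>z\<in>carrier G. \<Phi> \<gamma> z)" by (rule sum_translate[OF w(1)])
  finally show ?thesis using w(2) by simp
qed

text \<open>This says that the characters separate the points of \<open>G\<close>, and holds by counting. For fixed \<open>u\<close> the map
\<open>\<gamma> \<mapsto> \<Phi> \<gamma> u\<close> is itself a character of \<open>G\<close>, so each of these sums is \<open>0\<close> or the order of \<open>G\<close>.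
By the orthogonality of the characters \<open>\<Phi> \<gamma>\<close> they add up to the order of \<open>G\<close>, and the unit already
contributes this much.\<close>
lemma sum_labels:
  assumes u: "u \<in> carrier G"
  shows "(\<Sum>\<gamma>\<in>carrier G. \<Phi> \<gamma> u) = (if u = \<one> then of_nat (card (carrier G)) else 0)"
proof -
  define S where "S v = (\<Sum>\<gamma>\<in>carrier G. \<Phi> \<gamma> v)" for v
  have S1: "S \<one> = of_nat (card (carrier G))"
    by (simp add: S_def character_at_one)
  have dich: "S v = 0 \<or> S v = of_nat (card (carrier G))" if v: "v \<in> carrier G" for v
  proof (cases "\<forall>\<delta>\<in>carrier G. \<Phi> \<delta> v = 1")
    case True
    then show ?thesis by (simp add: S_def)
  next
    case False
    then obtain \<delta> where d: "\<delta> \<in> carrier G" "\<Phi> \<delta> v \<noteq> 1" by blast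
    have "\<Phi> \<delta> v * S v = (\<Sum>\<gamma>\<in>carrier G. \<Phi> (\<delta> \<otimes> \<gamma>) v)"
      using d v by (simp add: S_def sum_distrib_left label_mult)
    also have "\<dots> = S v" unfolding S_def by (rule sum_translate[OF d(1)])
    finally show ?thesis using d(2) by simp
  qed
  have "(\<Sum>v\<in>carrier G. S v) = (\<Sum>\<gamma>\<in>carrier G. \<Sum>v\<in>carrier G. \<Phi> \<gamma> v)"
    unfolding S_def by (rule sum.swap)
  also have "\<dots> = (\<Sum>\<gamma>\<in>carrier G. if \<gamma> = \<one> then of_nat (card (carrier G)) else 0)"
    by (intro sum.cong) (auto simp: sum_character trivial_character)
  also have "\<dots> = of_nat (card (carrier G))" using fin by simp
  finally have "S \<one> + (\<Sum>v\<in>carrier G - {\<one>}. S v) = of_nat (card (carrier G))"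
    using fin by (simp add: sum.remove[of _ \<one>])
  then have "(\<Sum>v\<in>carrier G - {\<one>}. S v) = 0" using S1 by simp
  then have "(\<Sum>v\<in>carrier G - {\<one>}. Re (S v)) = 0" by (metis Re_sum zero_complex.sel(1))
  moreover have "0 \<le> Re (S v)" if "v \<in> carrier G - {\<one>}" for v
    using dich[of v] that by auto
  ultimately have "\<forall>v\<in>carrier G - {\<one>}. Re (S v) = 0"
    using fin by (subst (asm) sum_nonneg_eq_0_iff) auto
  then have "Re (S u) = 0" if "u \<noteq> \<one>" using u that by blast
  then have "S u = 0" if "u \<noteq> \<one>" using dich[OF u] that by auto
  then show ?thesis using S1 unfolding S_def[symmetric] by simp
qed

lemma fourier_inversion:
  fixes p :: "'g \<Rightarrow> complex"
  assumes z: "z \<in> carrier G"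
  shows "(\<Sum>\<gamma>\<in>carrier G. (\<Sum>w\<in>carrier G. cnj (\<Phi> \<gamma> w) * p w) * \<Phi> \<gamma> z) = of_nat (card (carrier G)) * p z"
proof -
  have "(\<Sum>\<gamma>\<in>carrier G. (\<Sum>w\<in>carrier G. cnj (\<Phi> \<gamma> w) * p w) * \<Phi> \<gamma> z) =
      (\<Sum>\<gamma>\<in>carrier G. \<Sum>w\<in>carrier G. p w * \<Phi> \<gamma> (inv w \<otimes> z))"
    unfolding sum_distrib_right using z
    by (intro sum.cong refl) (simp add: character_mult character_cnj_inverse)
  also have "\<dots> = (\<Sum>w\<in>carrier G. p w * (\<Sum>\<gamma>\<in>carrier G. \<Phi> \<gamma> (inv w \<otimes> z)))"
    by (subst sum.swap) (simp add: sum_distrib_left)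
  also have "\<dots> = (\<Sum>w\<in>carrier G. if w = z then of_nat (card (carrier G)) * p w else 0)"
  proof (intro sum.cong refl)
    fix w assume w: "w \<in> carrier G"
    then have "inv w \<otimes> z = \<one> \<longleftrightarrow> w = z" using z by (metis inv_closed inv_inv inv_unique l_inv inv_equality)
    then show "p w * (\<Sum>\<gamma>\<in>carrier G. \<Phi> \<gamma> (inv w \<otimes> z)) = (if w = z then of_nat (card (carrier G)) * p w else 0)"
      using w z by (simp add: sum_labels)
  qed
  also have "\<dots> = of_nat (card (carrier G)) * p z" using z fin by simp
  finally show ?thesis .
qed

text \<open>In the inversion formula the coefficients with \<open>\<gamma> \<in> H\<close> are bounded by the sum of \<open>p\<close>, because
\<open>p \<ge> 0\<close>, and the others by \<open>e\<close>.\<close>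
lemma max_le_of_small_coefficients:
  fixes p :: "'g \<Rightarrow> real"
  assumes p: "\<And>z. z \<in> carrier G \<Longrightarrow> 0 \<le> p z"
    and H: "H \<subseteq> carrier G" and e: "0 \<le> e"
    and small: "\<And>\<gamma>. \<gamma> \<in> carrier G - H \<Longrightarrow> norm (\<Sum>w\<in>carrier G. cnj (\<Phi> \<gamma> w) * of_real (p w)) \<le> e"
    and z: "z \<in> carrier G"
  shows "p z \<le> real (card H) / real (card (carrier G)) * (\<Sum>w\<in>carrier G. p w) + e"
proof -
  define phat where "phat \<gamma> = (\<Sum>w\<in>carrier G. cnj (\<Phi> \<gamma> w) * complex_of_real (p w))" for \<gamma>
  have o: "0 < real (card (carrier G))" using fin one_closed by (auto simp: card_gt_0_iff)
  have triv: "norm (phat \<gamma>) \<le> (\<Sum>w\<in>carrier G. p w)" if "\<gamma> \<in> carrier G" for \<gamma>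
    unfolding phat_def using that p
    by (intro order_trans[OF norm_sum] sum_mono) (auto simp: norm_mult character_norm)
  have "real (card (carrier G)) * p z = norm (of_nat (card (carrier G)) * complex_of_real (p z))"
    using p[OF z] by (simp add: norm_mult)
  also have "\<dots> = norm (\<Sum>\<gamma>\<in>carrier G. phat \<gamma> * \<Phi> \<gamma> z)"
    unfolding phat_def by (subst fourier_inversion[OF z]) simp
  also have "\<dots> \<le> (\<Sum>\<gamma>\<in>carrier G. norm (phat \<gamma>))"
    by (intro order_trans[OF norm_sum] sum_mono) (use z in \<open>auto simp: norm_mult character_norm\<close>)
  also have "\<dots> = (\<Sum>\<gamma>\<in>H. norm (phat \<gamma>)) + (\<Sum>\<gamma>\<in>carrier G - H. norm (phat \<gamma>))"
    using fin H by (metis add.commute sum.subset_diff)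
  also have "\<dots> \<le> (\<Sum>\<gamma>\<in>H. \<Sum>w\<in>carrier G. p w) + (\<Sum>\<gamma>\<in>carrier G - H. e)"
    using triv H small by (intro add_mono sum_mono) (auto simp: phat_def)
  also have "\<dots> \<le> real (card H) * (\<Sum>w\<in>carrier G. p w) + real (card (carrier G)) * e"
    using e fin by (simp add: card_mono mult_right_mono)
  finally show ?thesis using o by (simp add: field_simps)
qed

end

section \<open>Almost rank one measures with restricted spectrum\<close>

lemma norm_vector_scalar_mult:
  fixes c :: complex and v :: "complex ^ 'l"
  shows "norm (c *s v) = norm c * norm v"
  by (simp add: norm_vec_def norm_mult L2_set_right_distrib)

lemma scaleR_eq_vector_scalar_mult:
  fixes v :: "complex ^ 'l"
  shows "r *\<^sub>R v = complex_of_real r *s v"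
  by (simp only: vec_eq_iff vector_scaleR_component vector_smult_component)
    (simp add: scaleR_conv_of_real)

lemma closed_complex_subspace:
  fixes V :: "(complex ^ 'l) set"
  assumes "vec.subspace V"
  shows "closed V"
proof (rule closed_subspace)
  show "subspace V"
    using assms unfolding subspace_def vec.subspace_def by (simp add: scaleR_eq_vector_scalar_mult)
qed

lemma separation_from_subspace:
  fixes V :: "(complex ^ 'l) set"
  assumes "vec.subspace V" "a \<notin> V"
  obtains c where "c > 0" "\<And>u. u \<in> V \<Longrightarrow> c \<le> norm (a - u)"
proof -
  have "open (- V)" by (intro open_Compl closed_complex_subspace assms)
  then obtain c where "c > 0" "ball a c \<subseteq> - V" using assms(2) by (meson ComplI open_contains_ball)
  then show ?thesis using that[of c] by (force simp: dist_norm)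
qed

text \<open>The distance from \<open>t *s a\<close> to a complex subspace scales with the modulus of \<open>t\<close>. This makes the exact
alternative "\<open>t = 0\<close> or \<open>a \<in> V\<close>" quantitative.\<close>
lemma coefficient_le_distance:
  fixes V :: "(complex ^ 'l) set"
  assumes V: "vec.subspace V" and c: "\<And>u. u \<in> V \<Longrightarrow> c \<le> norm (a - u)" and u: "u \<in> V"
  shows "norm t * c \<le> norm (u - t *s a)"
proof (cases "t = 0")
  case False
  have "(1 / t) *s u \<in> V" using V u by (rule vec.subspace_scale)
  then have "norm t * c \<le> norm t * norm (a - (1 / t) *s u)" by (intro mult_left_mono c) auto
  also have "\<dots> = norm (t *s a - u)"
    using False by (simp add: norm_vector_scalar_mult[symmetric] vec.scale_right_diff_distrib)
  finally show ?thesis by (simp add: norm_minus_commute)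
qed simp

context self_dual_group
begin

text \<open>The value \<open>w\<close> on the parent is the same for all children, so a nontrivial character does not see it:
the condition on the increment becomes a condition on the values on the children alone.\<close>
lemma fourier_of_increment:
  fixes v :: "'g \<Rightarrow> complex ^ 'l"
  assumes f: "f \<in> W_space G \<Phi> V" and fv: "\<And>j. j \<in> carrier G \<Longrightarrow> f j = r *\<^sub>R v j - w"
    and r: "r \<noteq> 0" and \<gamma>: "\<gamma> \<in> carrier G - {\<one>}" and V: "vec.subspace (V \<gamma>)"
  shows "fourier G \<Phi> v \<gamma> \<in> V \<gamma>"
proof -
  have "(\<Sum>z\<in>carrier G. cnj (\<Phi> \<gamma> z)) = 0"
    using sum_character[of \<gamma>] \<gamma> by (simp flip: cnj_sum)
  then have w0: "(\<Sum>z\<in>carrier G. cnj (\<Phi> \<gamma> z) *s w) = 0"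
    by (simp flip: vec.scale_sum_left)
  have "fourier G \<Phi> f \<gamma> = (\<Sum>z\<in>carrier G. complex_of_real r *s (cnj (\<Phi> \<gamma> z) *s v z) - cnj (\<Phi> \<gamma> z) *s w)"
    unfolding fourier_def
    by (intro sum.cong refl)
      (simp add: fv scaleR_eq_vector_scalar_mult vec.scale_right_diff_distrib mult.commute)
  also have "\<dots> = complex_of_real r *s fourier G \<Phi> v \<gamma>"
    by (simp add: sum_subtractf w0 fourier_def vec.scale_sum_right)
  finally have eq: "fourier G \<Phi> f \<gamma> = complex_of_real r *s fourier G \<Phi> v \<gamma>" .
  have "fourier G \<Phi> f \<gamma> \<in> V \<gamma>" using f \<gamma> by (simp add: W_space_def)
  then have "complex_of_real r *s fourier G \<Phi> v \<gamma> \<in> V \<gamma>" by (simp only: eq)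
  from vec.subspace_scale[OF V this, of "inverse (complex_of_real r)"] r
  show ?thesis by simp
qed

text \<open>A label outside \<open>H\<close> is not in \<open>W_inv G V a\<close>, so \<open>a\<close> lies outside one of the two closed subspaces
attached to it and to its inverse.\<close>
lemma uniform_separation:
  fixes V :: "'g \<Rightarrow> (complex ^ 'l) set"
  assumes V: "\<And>\<gamma>. \<gamma> \<in> carrier G - {\<one>} \<Longrightarrow> vec.subspace (V \<gamma>)"
    and H: "subgroup H G" "W_inv G V a \<subseteq> H"
  obtains c where "c > 0" "\<And>\<gamma>. \<gamma> \<in> carrier G - H \<Longrightarrow>
    (\<forall>u\<in>V \<gamma>. c \<le> norm (a - u)) \<or> (\<forall>u\<in>V (inv \<gamma>). c \<le> norm (a - u))"
proof -
  have "\<exists>c>0. (\<forall>u\<in>V \<gamma>. c \<le> norm (a - u)) \<or> (\<forall>u\<in>V (inv \<gamma>). c \<le> norm (a - u))"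
    if \<gamma>: "\<gamma> \<in> carrier G - H" for \<gamma>
  proof -
    have 1: "\<gamma> \<in> carrier G - {\<one>}" using \<gamma> subgroup.one_closed[OF H(1)] by auto
    then have 2: "inv \<gamma> \<in> carrier G - {\<one>}" using inv_eq_1_iff by auto
    have "a \<notin> V \<gamma> \<or> a \<notin> V (inv \<gamma>)" using 1 \<gamma> H(2) by (auto simp: W_inv_def)
    then show ?thesis
      using separation_from_subspace[OF V[OF 1], of a] separation_from_subspace[OF V[OF 2], of a] by metis
  qed
  then obtain c where c: "\<And>\<gamma>. \<gamma> \<in> carrier G - H \<Longrightarrow> c \<gamma> > 0"
    "\<And>\<gamma>. \<gamma> \<in> carrier G - H \<Longrightarrow>
      (\<forall>u\<in>V \<gamma>. c \<gamma> \<le> norm (a - u)) \<or> (\<forall>u\<in>V (inv \<gamma>). c \<gamma> \<le> norm (a - u))"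
    by metis
  let ?c = "Min (insert 1 (c ` (carrier G - H)))"
  have le: "?c \<le> c \<gamma>" if "\<gamma> \<in> carrier G - H" for \<gamma> using that fin by (intro Min_le) auto
  show ?thesis
  proof
    show "?c > 0" using fin c(1) by (subst Min_gr_iff) auto
    fix \<gamma> assume \<gamma>: "\<gamma> \<in> carrier G - H"
    show "(\<forall>u\<in>V \<gamma>. ?c \<le> norm (a - u)) \<or> (\<forall>u\<in>V (inv \<gamma>). ?c \<le> norm (a - u))"
      using c(2)[OF \<gamma>] le[OF \<gamma>] by (meson order_trans)
  qed
qed

text \<open>The key estimate. Here \<open>p\<close> and \<open>v\<close> are the masses and the vector measures of the children. At a label
outside \<open>H\<close> the coefficient of \<open>p\<close> is small if \<open>a\<close> is far from the subspace of that label. If \<open>a\<close>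
is only far from the subspace of the inverse label, the same holds there, and the two coefficients
have the same modulus since \<open>p\<close> is real.\<close>
lemma rank_one_mass_bound:
  fixes v :: "'g \<Rightarrow> complex ^ 'l" and p :: "'g \<Rightarrow> real"
  assumes p: "\<And>z. z \<in> carrier G \<Longrightarrow> 0 \<le> p z"
    and V: "\<And>\<gamma>. \<gamma> \<in> carrier G - {\<one>} \<Longrightarrow> vec.subspace (V \<gamma>)"
    and H: "subgroup H G" and c: "c > 0"
    and sep: "\<And>\<gamma>. \<gamma> \<in> carrier G - H \<Longrightarrow>
      (\<forall>u\<in>V \<gamma>. c \<le> norm (a - u)) \<or> (\<forall>u\<in>V (inv \<gamma>). c \<le> norm (a - u))"
    and v: "\<And>\<gamma>. \<gamma> \<in> carrier G - {\<one>} \<Longrightarrow> fourier G \<Phi> v \<gamma> \<in> V \<gamma>"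
    and err: "(\<Sum>z\<in>carrier G. norm (v z - p z *\<^sub>R a)) \<le> \<delta>"
    and z: "z \<in> carrier G"
  shows "p z \<le> real (card H) / real (card (carrier G)) * (\<Sum>w\<in>carrier G. p w) + \<delta> / c"
proof (rule max_le_of_small_coefficients[OF p subgroup.subset[OF H] _ _ z])
  have "0 \<le> (\<Sum>z\<in>carrier G. norm (v z - p z *\<^sub>R a))" by (intro sum_nonneg) auto
  then show "0 \<le> \<delta> / c" using err c by simp
  let ?phat = "\<lambda>\<gamma>. \<Sum>w\<in>carrier G. cnj (\<Phi> \<gamma> w) * complex_of_real (p w)"
  have bound: "norm (?phat \<gamma>) \<le> \<delta> / c"
    if \<gamma>: "\<gamma> \<in> carrier G - {\<one>}" and s: "\<forall>u\<in>V \<gamma>. c \<le> norm (a - u)" for \<gamma>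
  proof -
    have "norm (?phat \<gamma>) * c \<le> norm (fourier G \<Phi> v \<gamma> - ?phat \<gamma> *s a)"
      using s by (intro coefficient_le_distance[OF V[OF \<gamma>] _ v[OF \<gamma>]]) auto
    also have "fourier G \<Phi> v \<gamma> - ?phat \<gamma> *s a = (\<Sum>z\<in>carrier G. cnj (\<Phi> \<gamma> z) *s (v z - p z *\<^sub>R a))"
      by (simp add: fourier_def vec.scale_sum_left sum_subtractf vec.scale_right_diff_distrib
          scaleR_eq_vector_scalar_mult)
    also have "norm \<dots> \<le> (\<Sum>z\<in>carrier G. norm (v z - p z *\<^sub>R a))"
      using \<gamma> by (intro order_trans[OF norm_sum] sum_mono)
        (simp only: norm_vector_scalar_mult, simp add: character_norm)
    finally show ?thesis using err c by (simp add: field_simps)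
  qed
  fix \<gamma> assume \<gamma>: "\<gamma> \<in> carrier G - H"
  have 1: "\<gamma> \<in> carrier G - {\<one>}" using \<gamma> subgroup.one_closed[OF H] by auto
  then have 2: "inv \<gamma> \<in> carrier G - {\<one>}" using inv_eq_1_iff by auto
  have "?phat (inv \<gamma>) = cnj (?phat \<gamma>)" using 1 by (simp add: label_inverse)
  then have "norm (?phat (inv \<gamma>)) = norm (?phat \<gamma>)" by (simp only: complex_mod_cnj)
  then show "norm (?phat \<gamma>) \<le> \<delta> / c" using sep[OF \<gamma>] bound[OF 1] bound[OF 2] by auto
qed

end

section \<open>The tree of atoms\<close>

lemma path_dist_first_difference:
  assumes "x \<noteq> y"
  obtains k where "x k \<noteq> y k" "\<And>j. j < k \<Longrightarrow> x j = y j" "path_dist m x y = 1 / real m ^ k"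
proof -
  define k where "k = (LEAST k. x k \<noteq> y k)"
  have "\<exists>k. x k \<noteq> y k" using assms by (meson ext)
  then have 1: "x k \<noteq> y k" unfolding k_def by (rule LeastI_ex)
  have 2: "x j = y j" if "j < k" for j using not_less_Least that unfolding k_def by blast
  show ?thesis
  proof (rule that[of k])
    show "path_dist m x y = 1 / real m ^ k" by (rule path_dist_eq) (use 1 2 in blast)+
  qed (use 1 2 in blast)+
qed

text \<open>Small balls and cylinders are contained in each other, so cylinders are open, and open sets are
countable unions of cylinders.\<close>
lemma path_space_borel_sets:
  fixes \<Omega> :: "(nat \<Rightarrow> 'w set) set"
  assumes ps: "path_space \<Omega>" and ms: "Metric_space \<Omega> (path_dist m)" and m: "m \<ge> 2"
  shows "Metric_space.borel_sets \<Omega> (path_dist m) = sigma_sets \<Omega> (path_space.level_sets \<Omega>)"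
proof -
  interpret path_space \<Omega> by (rule ps)
  interpret ms: Metric_space \<Omega> "path_dist m" by (rule ms)
  have m1: "real m > 1" using m by simp
  have pow: "1 / real m ^ k < 1 / real m ^ n \<longleftrightarrow> n < k" for k n
    using m1 by (simp add: frac_less2 divide_less_cancel field_simps)
  have ball: "ms.mball x (1 / real m ^ n) \<subseteq> cyl n x" for x n
  proof
    fix y assume y: "y \<in> ms.mball x (1 / real m ^ n)"
    show "y \<in> cyl n x"
    proof (cases "x = y")
      case False
      then obtain k where k: "\<And>j. j < k \<Longrightarrow> x j = y j" "path_dist m x y = 1 / real m ^ k"
        by (rule path_dist_first_difference) blast
      then have "n < k" using y pow by simp
      then show ?thesis using k(1) y by (simp add: cyl_def)
    qed (use y in \<open>simp add: cyl_def\<close>)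
  qed
  have cyl_ball: "cyl n x \<subseteq> ms.mball x r" if x: "x \<in> \<Omega>" and r: "1 / real m ^ n < r" for x n r
  proof
    fix y assume y: "y \<in> cyl n x"
    have "path_dist m x y < r"
    proof (cases "x = y")
      case True
      have "0 < 1 / real m ^ n" using m1 by simp
      then have "0 < r" using r by linarith
      then show ?thesis using True by (simp add: path_dist_def)
    next
      case False
      then obtain k where k: "x k \<noteq> y k" "path_dist m x y = 1 / real m ^ k"
        by (rule path_dist_first_difference) blast
      have "n < k"
      proof (rule ccontr)
        assume "\<not> n < k"
        then have "x k = y k" using y by (intro coherent[OF x, of y n k]) (auto simp: cyl_def)
        then show False using k(1) by simp
      qed
      then show ?thesis using pow[of k n] k(2) r by linarith
    qed
    then show "y \<in> ms.mball x r" using x y by (simp add: cyl_def)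
  qed
  have "level_sets \<subseteq> {U. openin ms.mtopology U}"
  proof
    fix C assume C: "C \<in> level_sets"
    then obtain N where N: "C \<subseteq> \<Omega>" "\<And>x n. x \<in> C \<Longrightarrow> n \<ge> N \<Longrightarrow> cyl n x \<subseteq> C"
      unfolding level_sets_def by blast
    have "\<exists>r>0. ms.mball x r \<subseteq> C" if "x \<in> C" for x
      using ball[of x N] N(2)[OF that, of N] m1 by (intro exI[of _ "1 / real m ^ N"]) auto
    then show "C \<in> {U. openin ms.mtopology U}" using N(1) by (auto simp: ms.openin_mtopology)
  qed
  then have 1: "sigma_sets \<Omega> level_sets \<subseteq> ms.borel_sets"
    unfolding ms.borel_sets_def by (intro sigma_sets_mono') auto
  interpret sa: sigma_algebra \<Omega> "sigma_sets \<Omega> level_sets"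
    by (rule sigma_algebra_sigma_sets) (auto simp: level_sets_def)
  have "U \<in> sigma_sets \<Omega> level_sets" if U: "openin ms.mtopology U" for U
  proof -
    let ?\<C> = "{Q \<in> {cyl n x |n x. x \<in> \<Omega>}. Q \<subseteq> U}"
    have "U \<subseteq> \<Union>?\<C>"
    proof
      fix x assume x: "x \<in> U"
      then obtain r where r: "r > 0" "ms.mball x r \<subseteq> U" and x\<Omega>: "x \<in> \<Omega>"
        using U unfolding ms.openin_mtopology by blast
      obtain n where "(1 / real m) ^ n < r" using real_arch_pow_inv[OF r(1), of "1 / real m"] m1 by auto
      then have "cyl n x \<subseteq> U" using cyl_ball[OF x\<Omega>, of n r] r(2) by (simp add: power_one_over)
      then show "x \<in> \<Union>?\<C>" using cyl_self[OF x\<Omega>, of n] x\<Omega> by blast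
    qed
    then have "U = \<Union>?\<C>" by blast
    moreover have "\<Union>?\<C> \<in> sigma_sets \<Omega> level_sets"
    proof (rule sa.countable_Union)
      show "countable ?\<C>" by (rule countable_subset[OF _ countable_cyls]) auto
      show "?\<C> \<subseteq> sigma_sets \<Omega> level_sets" using cyl_level_set by auto
    qed
    ultimately show ?thesis by simp
  qed
  then have "ms.borel_sets \<subseteq> sigma_sets \<Omega> level_sets"
    unfolding ms.borel_sets_def by (intro sa.sigma_sets_subset) auto
  then show ?thesis using 1 by blast
qed

lemma atoms_eqI:
  assumes "a \<in> atoms A" "b \<in> atoms A" "x \<in> a" "x \<in> b"
  shows "a = b"
proof -
  have s: "a \<inter> b \<in> sets A" "a \<inter> b \<noteq> {}" using assms by (auto simp: atoms_def)
  then have "\<not> a \<inter> b \<subset> a" "\<not> a \<inter> b \<subset> b" using assms(1,2) by (auto simp: atoms_def)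
  then show ?thesis by blast
qed

lemma atom_nonempty: "a \<in> atoms A \<Longrightarrow> a \<noteq> {}"
  by (simp add: atoms_def)

context uniform_filtration
begin

lemma finite_atoms: "finite (atoms (F n))"
  by (rule finite_subset[OF _ finite_F[of n]]) (auto simp: atoms_def)

lemma path_space_paths: "path_space (paths F)"
proof
  fix x y and n k :: nat
  assume x: "x \<in> paths F" and y: "y \<in> paths F" and eq: "x n = y n" and "k \<le> n"
  have dec: "z n \<subseteq> z k" if "z \<in> paths F" for z
  proof -
    have "z (Suc i) \<subseteq> z i" for i using that by (simp add: paths_def)
    then show ?thesis using \<open>k \<le> n\<close> by (rule lift_Suc_antimono_le)
  qed
  have at: "x i \<in> atoms (F i)" "y i \<in> atoms (F i)" for i using x y by (auto simp: paths_def)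
  obtain w where w: "w \<in> x n" using atom_nonempty[OF at(1)] by blast
  have "w \<in> x k" "w \<in> y k" using w dec[OF x] dec[OF y] eq by auto
  then show "x k = y k" by (rule atoms_eqI[OF at])
next
  show "finite ((\<lambda>x. x n) ` paths F)" for n
    by (rule finite_subset[OF _ finite_atoms[of n]]) (auto simp: paths_def)
qed

lemma cyl_eq_cylinder: "path_space.cyl (paths F) n x = cylinder F n (x n)"
  by (simp add: path_space.cyl_def[OF path_space_paths] cylinder_def)

lemma cylinder_children:
  assumes \<omega>: "\<omega> \<in> atoms (F n)"
  shows "cylinder F n \<omega> = (\<Union>\<omega>'\<in>children F n \<omega>. cylinder F (Suc n) \<omega>')"
proof (intro equalityI subsetI)
  fix x assume x: "x \<in> cylinder F n \<omega>"
  then show "x \<in> (\<Union>\<omega>'\<in>children F n \<omega>. cylinder F (Suc n) \<omega>')"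
    by (auto simp: cylinder_def paths_def children_def)
next
  fix x assume "x \<in> (\<Union>\<omega>'\<in>children F n \<omega>. cylinder F (Suc n) \<omega>')"
  then have x: "x \<in> paths F" "x (Suc n) \<subseteq> \<omega>" by (auto simp: cylinder_def children_def)
  then have "x (Suc n) \<subseteq> x n" "x n \<in> atoms (F n)" "x (Suc n) \<in> atoms (F (Suc n))"
    by (auto simp: paths_def)
  moreover from this(3) have "x (Suc n) \<noteq> {}" by (rule atom_nonempty)
  ultimately have "x n = \<omega>" using x(2) \<omega> atoms_eqI[of "x n" "F n" \<omega>] by blast
  then show "x \<in> cylinder F n \<omega>" using x by (simp add: cylinder_def)
qed

lemma measure_martingale_eq:
  assumes "\<omega> \<in> atoms (F n)" "x \<in> \<omega>"
  shows "measure_martingale F m \<mu> n x = real m ^ n *\<^sub>R \<mu> (cylinder F n \<omega>)"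
proof -
  have "indicator \<omega>' x *\<^sub>R (real m ^ n *\<^sub>R \<mu> (cylinder F n \<omega>')) =
      (if \<omega>' = \<omega> then real m ^ n *\<^sub>R \<mu> (cylinder F n \<omega>) else 0)" if "\<omega>' \<in> atoms (F n)" for \<omega>'
  proof (cases "\<omega>' = \<omega>")
    case False
    then have "x \<notin> \<omega>'" using atoms_eqI[OF that assms(1) _ assms(2)] by blast
    then show ?thesis using False by simp
  qed (use assms(2) in simp)
  then show ?thesis
    unfolding measure_martingale_def using assms finite_atoms by (simp cong: sum.cong)
qed

text \<open>The martingale takes a single value on each atom, which can be read off at any of its points. Evaluating
the increment at one point of each child leaves a relation between values of \<open>\<mu>\<close> on cylinders, in
which the sample space no longer occurs.\<close>
lemma martingale_difference_on_atom:
  assumes mem: "measure_martingale F m \<mu> \<in> W_martingales M F G J W"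
    and \<omega>: "\<omega> \<in> atoms (F n)" and J: "bij_betw (J \<omega>) (carrier G) (children F n \<omega>)"
  obtains f where "f \<in> W" "\<And>j. j \<in> carrier G \<Longrightarrow>
    f j = real m ^ Suc n *\<^sub>R \<mu> (cylinder F (Suc n) (J \<omega> j)) - real m ^ n *\<^sub>R \<mu> (cylinder F n \<omega>)"
proof -
  let ?X = "measure_martingale F m \<mu>"
  have "(\<lambda>x\<in>\<omega>. ?X (Suc n) x - ?X n x) \<in> lift_to_atom G J \<omega> ` W"
    using mem \<omega> by (simp add: W_martingales_def)
  then obtain f where f: "f \<in> W" and eq: "(\<lambda>x\<in>\<omega>. ?X (Suc n) x - ?X n x) = lift_to_atom G J \<omega> f"
    by blast
  show ?thesis
  proof (rule that[OF f])
    fix j assume j: "j \<in> carrier G"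
    have child: "J \<omega> i \<in> atoms (F (Suc n))" "J \<omega> i \<subseteq> \<omega>" if "i \<in> carrier G" for i
      using bij_betwE[OF J] that by (auto simp: children_def)
    obtain x where x: "x \<in> J \<omega> j" using atom_nonempty[OF child(1)[OF j]] by blast
    have "(THE i. i \<in> carrier G \<and> x \<in> J \<omega> i) = j"
    proof (rule the_equality)
      fix i assume i: "i \<in> carrier G \<and> x \<in> J \<omega> i"
      then have "J \<omega> i = J \<omega> j" using atoms_eqI[OF child(1) child(1)[OF j] _ x] by blast
      then show "i = j" using J i j by (auto simp: bij_betw_def dest: inj_onD)
    qed (use j x in auto)
    then have "f j = lift_to_atom G J \<omega> f x"
      using x child(2)[OF j] by (auto simp: lift_to_atom_def)
    also have "\<dots> = ?X (Suc n) x - ?X n x"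
      using x child(2)[OF j] by (subst eq[symmetric]) auto
    also have "\<dots> = real m ^ Suc n *\<^sub>R \<mu> (cylinder F (Suc n) (J \<omega> j)) - real m ^ n *\<^sub>R \<mu> (cylinder F n \<omega>)"
      using measure_martingale_eq[OF child(1)[OF j] x] measure_martingale_eq[OF \<omega>] x child(2)[OF j]
      by (metis subsetD)
    finally show "f j = real m ^ Suc n *\<^sub>R \<mu> (cylinder F (Suc n) (J \<omega> j)) - real m ^ n *\<^sub>R \<mu> (cylinder F n \<omega>)" .
  qed
qed

end

section \<open>The dimension bound\<close>

theorem corollary5p1:
  fixes m K :: nat
    and M :: "'w measure" and F :: "nat \<Rightarrow> 'w measure"
    and G :: "nat monoid" and \<Phi> :: "nat \<Rightarrow> nat \<Rightarrow> complex"
    and V :: "nat \<Rightarrow> (complex ^ 'l) set"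
    and J :: "'w set \<Rightarrow> nat \<Rightarrow> 'w set"
    and \<mu> :: "(nat \<Rightarrow> 'w set) set \<Rightarrow> complex ^ 'l"
  assumes "m \<ge> 3"
    and "uniform_filtration M F m"
    and "comm_group G" and "carrier G = {1..m}"
    and "\<Phi> \<in> iso G (dual_group G)"
    and "\<And>\<gamma>. \<gamma> \<in> carrier G - {\<one>\<^bsub>G\<^esub>} \<Longrightarrow> vec.subspace (V \<gamma>)"
    and "\<And>n \<omega>. \<omega> \<in> atoms (F n) \<Longrightarrow> bij_betw (J \<omega>) (carrier G) (children F n \<omega>)"
    and "\<And>a :: complex ^ 'l. a \<noteq> 0 \<Longrightarrow> \<exists>H. subgroup H G \<and> card H = K \<and> W_inv G V a \<subseteq> H"
    and "Metric_space.bounded_variation_measure (paths F) (path_dist m) \<mu>"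
    and "measure_martingale F m \<mu> \<in> W_martingales M F G J (W_space G \<Phi> V)"
  shows "Metric_space.lower_hausdorff_dim (paths F) (path_dist m) \<mu>
           \<ge> ereal (1 - ln (real K) / ln (real m))"
proof -
  interpret U: uniform_filtration M F m by (rule assms(2))
  interpret path_space "paths F" by (rule U.path_space_paths)
  interpret ms: Metric_space "paths F" "path_dist m" using assms(1) by (intro Metric_space_paths) simp
  interpret G: self_dual_group G \<Phi>
    using assms(3,4,5) by (intro self_dual_group.intro self_dual_group_axioms.intro) auto
  have m: "m \<ge> 2" "real m > 1" using assms(1) by auto
  have cardG: "card (carrier G) = m" using assms(4) by simp
  have borel: "ms.borel_sets = sigma_sets (paths F) level_sets"
    by (rule path_space_borel_sets[OF path_space_axioms ms.Metric_space_axioms m(1)])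
  have sig: "sigma_algebra (paths F) ms.borel_sets"
    unfolding borel by (rule sigma_algebra_sigma_sets) (auto simp: level_sets_def)
  have ca: "countably_additive_vec ms.borel_sets \<mu>"
    using assms(9) unfolding ms.bounded_variation_measure_def countably_additive_vec_def by blast
  obtain C where C: "\<And>P. finite P \<Longrightarrow> P \<subseteq> ms.borel_sets \<Longrightarrow> disjoint P \<Longrightarrow> (\<Sum>A\<in>P. norm (\<mu> A)) \<le> C"
    using assms(9) unfolding ms.bounded_variation_measure_def by blast
  define \<Lambda> where "\<Lambda> = variation_measure (paths F) ms.borel_sets \<mu>"
  note L = variation_measure[OF sig ca C, folded \<Lambda>_def]
  interpret L: path_measure "paths F" \<Lambda>
  proof (intro path_measure.intro path_measure_axioms.intro)
    show "path_space (paths F)" by (rule path_space_axioms)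
    show "finite_measure \<Lambda>" by (rule L(3))
    show "space \<Lambda> = paths F" by (rule L(2))
    show "sets \<Lambda> = sigma_sets (paths F) level_sets" using L(1) borel by simp
  qed
  obtain f where f: "integrable \<Lambda> f" "\<And>A. A \<in> sets \<Lambda> \<Longrightarrow> \<mu> A = (\<integral>x\<in>A. f x \<partial>\<Lambda>)"
    using L.vector_density_exists[of \<mu>] ca L(1,4) by metis
  have "ereal (1 - ln (real K) / ln (real m)) \<le> \<alpha>"
    if E: "E \<in> ms.borel_sets" "\<mu> E \<noteq> 0" "ms.hausdorff_dim E \<le> \<alpha>" for E \<alpha>
  proof (rule ccontr)
    assume "\<not> ?thesis"
    then have "ms.hausdorff_dim E < ereal (1 - ln (real K) / ln (real m))" using E(3) by auto
    then obtain s where s: "0 \<le> s" "ms.hausdorff_measure s E = 0" "s < 1 - ln (real K) / ln (real m)"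
      unfolding ms.hausdorff_dim_def Inf_less_iff by auto
    have Es: "E \<in> sets \<Lambda>" using E(1) L(1) by simp
    have nz: "(\<integral>x\<in>E. f x \<partial>\<Lambda>) \<noteq> 0" using f(2)[OF Es] E(2) by simp
    obtain a where a: "a \<noteq> 0" "\<And>r. r > 0 \<Longrightarrow> 0 < measure \<Lambda> {x\<in>E. norm (f x - a) < r}"
      using L.essential_value_exists[OF f(1) Es nz] by blast
    obtain H where H: "subgroup H G" "card H = K" "W_inv G V a \<subseteq> H" using assms(8)[OF a(1)] by blast
    obtain c where c: "c > 0" "\<And>\<gamma>. \<gamma> \<in> carrier G - H \<Longrightarrow>
        (\<forall>u\<in>V \<gamma>. c \<le> norm (a - u)) \<or> (\<forall>u\<in>V (inv\<^bsub>G\<^esub> \<gamma>). c \<le> norm (a - u))"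
      using G.uniform_separation[OF assms(6) H(1,3)] by blast
    have K: "K > 0"
    proof -
      have "finite H" using subgroup.subset[OF H(1)] assms(4) finite_subset by auto
      then show ?thesis using H(2) subgroup.one_closed[OF H(1)] by (auto simp: card_gt_0_iff)
    qed
    define q where "q = real m powr (- s)"
    have Kq: "real K / real m < q"
    proof -
      have "ln (real K) < (1 - s) * ln (real m)"
        using s(3) m(2) by (simp add: field_simps)
      then have "real K < real m powr (1 - s)"
        using K m(2) by (simp add: powr_def ln_less_cancel_iff[symmetric] del: ln_less_cancel_iff)
      also have "\<dots> = real m * q" using m(2) by (simp add: q_def powr_diff powr_minus_divide)
      finally show ?thesis using m(2) by (simp add: field_simps)
    qed
    \<comment> \<open>Chosen such that \<open>K / m + 2 * e / c = q\<close>.\<close>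
    define e where "e = c * (q - real K / real m) / 2"
    have e: "e > 0" using Kq c(1) by (simp add: e_def)
    define A where "A = {x\<in>E. norm (f x - a) < e}"
    define h where "h x = norm (f x - a)" for x
    have hint: "integrable \<Lambda> h" unfolding h_def using f(1) by auto
    have As: "A \<in> sets \<Lambda>"
    proof -
      have [measurable]: "h \<in> borel_measurable \<Lambda>" using hint by auto
      have "A = E \<inter> {x \<in> space \<Lambda>. h x < e}"
        using sets.sets_into_space[OF Es] by (auto simp: A_def h_def)
      then show ?thesis using Es by simp
    qed
    obtain A' N where A': "A' \<in> sets \<Lambda>" "A' \<subseteq> A" "0 < measure \<Lambda> A'"
      "\<And>x n. x \<in> A' \<Longrightarrow> n \<ge> N \<Longrightarrow> (\<integral>y\<in>cyl n x. h y \<partial>\<Lambda>) \<le> 2 * e * measure \<Lambda> (cyl n x)"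
    proof (rule L.density_points[OF hint _ As _ e])
      show "0 < measure \<Lambda> A" unfolding A_def by (rule a(2)[OF e])
    qed (auto simp: h_def A_def)
    \<comment> \<open>The child that contains \<open>x\<close> carries at most the fraction \<open>q\<close> of the mass of its parent.\<close>
    have decay: "measure \<Lambda> (cyl (Suc n) x) \<le> q * measure \<Lambda> (cyl n x)" if x: "x \<in> A'" and n: "n \<ge> N" for x n
    proof -
      have xp: "x \<in> paths F" using sets.sets_into_space[OF A'(1)] x L(2) by auto
      define \<omega> where "\<omega> = x n"
      have \<omega>: "\<omega> \<in> atoms (F n)" using xp by (simp add: \<omega>_def paths_def)
      note J = assms(7)[OF \<omega>]
      define Q where "Q j = cylinder F (Suc n) (J \<omega> j)" for j
      have Qs: "Q j \<in> sets \<Lambda>" for j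
      proof (cases "Q j = {}")
        case False
        then obtain y where "y \<in> Q j" by blast
        then have "y \<in> paths F" "Q j = cyl (Suc n) y"
          by (auto simp: Q_def cylinder_def cyl_def)
        then show ?thesis using L.cyl_sets by simp
      qed simp
      have disj: "disjoint_family_on Q (carrier G)"
        unfolding disjoint_family_on_def
      proof (intro ballI impI)
        fix i j assume "i \<in> carrier G" "j \<in> carrier G" "i \<noteq> j"
        then have "J \<omega> i \<noteq> J \<omega> j" using J by (auto simp: bij_betw_def dest: inj_onD)
        then show "Q i \<inter> Q j = {}" by (auto simp: Q_def cylinder_def)
      qed
      have un: "cyl n x = (\<Union>j\<in>carrier G. Q j)"
        using U.cylinder_children[OF \<omega>] J
        by (simp add: U.cyl_eq_cylinder \<omega>_def[symmetric] Q_def bij_betw_def flip: image_image)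
      have intQ: "set_integrable \<Lambda> (Q j) g" if "integrable \<Lambda> g"
        for j and g :: "(nat \<Rightarrow> 'w set) \<Rightarrow> 'c :: {banach, second_countable_topology}"
        unfolding set_integrable_def using Qs that by (rule integrable_mult_indicator)
      have err: "(\<Sum>j\<in>carrier G. norm (\<mu> (Q j) - measure \<Lambda> (Q j) *\<^sub>R a)) \<le> 2 * e * measure \<Lambda> (cyl n x)"
      proof -
        have "norm (\<mu> (Q j) - measure \<Lambda> (Q j) *\<^sub>R a) \<le> (\<integral>y\<in>Q j. h y \<partial>\<Lambda>)" for j
        proof -
          have "(\<integral>y\<in>Q j. (f y - a) \<partial>\<Lambda>) = (\<integral>y\<in>Q j. f y \<partial>\<Lambda>) - (\<integral>y\<in>Q j. a \<partial>\<Lambda>)"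
            by (intro set_integral_diff intQ f(1)) simp
          also have "(\<integral>y\<in>Q j. a \<partial>\<Lambda>) = measure \<Lambda> (Q j) *\<^sub>R a"
            using Qs[of j] intQ[of "\<lambda>_. 1 :: real" j]
            by (simp add: set_lebesgue_integral_def set_integrable_def)
          finally have "\<mu> (Q j) - measure \<Lambda> (Q j) *\<^sub>R a = (\<integral>y\<in>Q j. (f y - a) \<partial>\<Lambda>)"
            using f(2)[OF Qs] by simp
          also have "norm \<dots> \<le> (\<integral>y. norm (indicator (Q j) y *\<^sub>R (f y - a)) \<partial>\<Lambda>)"
            unfolding set_lebesgue_integral_def by (rule integral_norm_bound)
          also have "\<dots> = (\<integral>y\<in>Q j. h y \<partial>\<Lambda>)"
            by (simp add: set_lebesgue_integral_def h_def)
          finally show ?thesis .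
        qed
        then have "(\<Sum>j\<in>carrier G. norm (\<mu> (Q j) - measure \<Lambda> (Q j) *\<^sub>R a)) \<le> (\<Sum>j\<in>carrier G. \<integral>y\<in>Q j. h y \<partial>\<Lambda>)"
          by (intro sum_mono)
        also have "\<dots> = (\<integral>y\<in>cyl n x. h y \<partial>\<Lambda>)"
          unfolding un using G.fin disj Qs intQ[OF hint]
          by (intro set_integral_finite_Union[symmetric]) auto
        also have "\<dots> \<le> 2 * e * measure \<Lambda> (cyl n x)" by (rule A'(4)[OF x n])
        finally show ?thesis .
      qed
      obtain g where g: "g \<in> W_space G \<Phi> V" "\<And>j. j \<in> carrier G \<Longrightarrow>
          g j = real m ^ Suc n *\<^sub>R \<mu> (Q j) - real m ^ n *\<^sub>R \<mu> (cylinder F n \<omega>)"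
        unfolding Q_def by (rule U.martingale_difference_on_atom[where J = J, OF assms(10) \<omega> J]) blast
      have spec: "fourier G \<Phi> (\<lambda>j. \<mu> (Q j)) \<gamma> \<in> V \<gamma>" if "\<gamma> \<in> carrier G - {\<one>\<^bsub>G\<^esub>}" for \<gamma>
        using m(2) by (intro G.fourier_of_increment[OF g(1,2) _ that assms(6)[OF that]]) auto
      have "x (Suc n) \<in> children F n \<omega>" using xp by (auto simp: paths_def children_def \<omega>_def)
      then obtain z where z: "z \<in> carrier G" "x (Suc n) = J \<omega> z" using J by (auto simp: bij_betw_def)
      have "measure \<Lambda> (Q z) \<le> real (card H) / real (card (carrier G)) * (\<Sum>w\<in>carrier G. measure \<Lambda> (Q w))
          + 2 * e * measure \<Lambda> (cyl n x) / c"
        by (rule G.rank_one_mass_bound[OF _ assms(6) H(1) c spec err z(1)]) auto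
      also have "(\<Sum>w\<in>carrier G. measure \<Lambda> (Q w)) = measure \<Lambda> (cyl n x)"
        unfolding un using G.fin disj Qs by (intro L.finite_measure_finite_Union[symmetric]) auto
      also have "real (card H) / real (card (carrier G)) * measure \<Lambda> (cyl n x)
          + 2 * e * measure \<Lambda> (cyl n x) / c = q * measure \<Lambda> (cyl n x)"
        using c(1) by (simp add: e_def H(2) cardG field_simps)
      finally show ?thesis by (simp add: U.cyl_eq_cylinder z(2) Q_def)
    qed
    have "ms.hausdorff_measure s E \<noteq> 0"
      using A'(2) by (intro hausdorff_measure_nonzero[OF L.path_measure_axioms ms.Metric_space_axioms m(1)
        s(1) q_def A'(1,3) _ decay]) (auto simp: A_def)
    then show False using s(2) by simp
  qed
  then show ?thesis
    unfolding ms.lower_hausdorff_dim_def by (intro Inf_greatest) auto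
qed

end
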